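(* Let $\mathcal{K}\subset\mathbb{R}^d$ be a bounded rectangular domain, let $\bar\omega$ be a modulus of continuity, and let $V:\mathbb{R}^d\times\mathcal{P}_2(\mathbb{R}^d)\to\mathbb{R}^p$ be a continuous function. Then for every $\varepsilon>0$ there exist $K\in\mathbb{N}^*$ and a neural network $\Phi$ on $\mathbb{R}^d\times\mathbb{R}^K$ (with values in $\mathbb{R}^p$) such that $$\big|V(x,\mu)-\Phi(x,\boldsymbol{p}^\mu)\big|\le\varepsilon\qquad\text{for all }x\in\mathcal{K}\text{ and all }\mu\in\mathcal{D}_c^{\bar\omega}(\mathcal{K}),$$ where $\boldsymbol{p}^\mu$ denotes the vector of density bins of $\mu$ associated with the division of $\mathcal{K}$ into $K$ bins.
   Context: $\mathcal{P}_2(\mathbb{R}^d)$ is the Wasserstein space of square-integrable probability measures on $\mathbb{R}^d$, equipped with the 2-Wasserstein distance; $|\cdot|$ is the Euclidean norm; $d,p\ge 1$ are integers; $\mathbb{N}^*=\{1,2,\dots\}$. Domain and bins: a bounded rectangular domain is $\mathcal{K}=\prod_{i=1}^d[a_i,b_i]$ with $a_i<b_i$. For $K=\bar K^d$ with $\bar K\in\mathbb{N}^*$, $\mathcal{K}$ is divided into $K$ bins $\mathrm{Bin}(1),\dots,\mathrm{Bin}(K)$ by cutting each side of $\mathcal{K}$ into $\bar K$ intervals of equal length; $x_k$ is the center of $\mathrm{Bin}(k)$, and all bins have the same Lebesgue measure $h=\lambda_d(\mathcal{K})/K$, where $\lambda_d$ is Lebesgue measure on $\mathbb{R}^d$. The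 integer $K$ in the claim is of this form. Density bins: for $\mu\in\mathcal{P}_2(\mathbb{R}^d)$ with density function $\mathrm{p}^\mu$ with respect to $\lambda_d$, its density bins are $\boldsymbol{p}^\mu=(p_k^\mu)_{1\le k\le K}$ with $$p_k^\mu=\frac{\mathrm{p}^\mu(x_k)}{\sum_{j=1}^K\mathrm{p}^\mu(x_j)\,h},\qquad k=1,\dots,K,$$ a vector lying in $\{\boldsymbol{p}=(p_k)_{1\le k\le K}\in\mathbb{R}_+^K:\sum_{k=1}^Kp_kh=1\}$. Class of measures: a modulus of continuity is a nondecreasing function $\bar\omega$ on $\mathbb{R}_+$ with $\lim_{t\downarrow0}\bar\omega(t)=\bar\omega(0)=0$. $\mathcal{D}_c(\mathcal{K})$ is the set of $\mu\in\mathcal{P}_2(\mathbb{R}^d)$ with support in $\mathcal{K}$ that admit a continuous density function $\mathrm{p}^\mu$ with respect to $\lambda_d$. For $\mu\in\mathcal{D}_c(\mathcal{K})$, $\omega_{\mathcal{K}}^\mu(t)=\sup\{|\mathrm{p}^\mu(x)-\mathrm{p}^\mu(y)|:x,y\in\mathcal{K},|x-y|\le t\}$ is its modulus of uniform continuity on $\mathcal{K}$. $\mathcal{D}_c^{\bar\omega}(\mathcal{K})$ is the set of $\mu\in\mathcal{D}_c(\mathcal{K})$ such that $\omega_{\mathcal{K}}^\mu\le\bar\omega$ on a neighborhood of $t=0$. Neural networks: a neural network from $\mathbb{R}^m$ to $\mathbb{R}^p$ is a feedforward network, i.e. a map $A_{L+1}\circ\sigma\circ A_L\circ\cdots\circ\sigma\circ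 A_1$ with $L\ge1$ hidden layers of arbitrary widths $d_1,\dots,d_L$, where $A_\ell(z)=w_\ell z+b_\ell\in\mathbb{R}^{d_\ell}$ are affine maps ($d_{L+1}=p$), and the activation function $\sigma:\mathbb{R}\to\mathbb{R}$ is applied componentwise, $\sigma$ being e.g. $\tanh$, sigmoid $t\mapsto 1/(1+e^{-t})$, or ReLU $t\mapsto\max(t,0)$. Here $m=d+K$.
   Formalization: The neighborhood of t=0 on which the density modulus is bounded by the given modulus is fixed for the whole class of measures; if it may depend on the measure, the claim fails (e.g. modulus sqrt(t) on [0,1], where all Lipschitz densities qualify and density bins can be 0/0). *)

theory Defs
  imports "HOL-Probability.Probability" "Jordan_Normal_Form.Matrix"
begin

no_notation Matrix.vec_index (infixl "$" 100)
no_notation Matrix.scalar_prod (infix "\<bullet>" 70)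
hide_const (open) Matrix.vec

section \<open>The 2-Wasserstein space\<close>

definition P2 :: "('a::euclidean_space) measure set" where
  "P2 = {\<mu>. prob_space \<mu> \<and> sets \<mu> = sets borel \<and> integrable \<mu> (\<lambda>x. (norm x)\<^sup>2)}"

definition couplings :: "('a::euclidean_space) measure \<Rightarrow> 'a measure \<Rightarrow> ('a \<times> 'a) measure set" where
  "couplings \<mu> \<nu> = {\<pi>. sets \<pi> = sets borel \<and> distr \<pi> borel fst = \<mu> \<and> distr \<pi> borel snd = \<nu>}"

definition W2 :: "('a::euclidean_space) measure \<Rightarrow> 'a measure \<Rightarrow> real" where
  "W2 \<mu> \<nu> = sqrt (enn2real (INF \<pi> \<in> couplings \<mu> \<nu>. \<integral>\<^sup>+ z. ennreal ((dist (fst z) (snd z))\<^sup>2) \<partial>\<pi>))"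

text \<open>
  Continuity of a map on \<open>\<real>\<^sup>d \<times> P2\<close>, for the product of the Euclidean and the Wasserstein
  distance. The values of \<open>V\<close> at measures outside \<^const>\<open>P2\<close> are irrelevant.
\<close>

definition W2_continuous ::
    "('a::euclidean_space \<Rightarrow> 'a measure \<Rightarrow> 'b::euclidean_space) \<Rightarrow> bool" where
  "W2_continuous V \<longleftrightarrow>
     (\<forall>x. \<forall>\<mu>\<in>P2. \<forall>e>0. \<exists>\<delta>>0. \<forall>y. \<forall>\<nu>\<in>P2.
        dist x y < \<delta> \<longrightarrow> W2 \<mu> \<nu> < \<delta> \<longrightarrow> dist (V x \<mu>) (V y \<nu>) < e)"


section \<open>Measures with continuous density on a box\<close>

definition measure_support :: "('a::topological_space) measure \<Rightarrow> 'a set" where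
  "measure_support \<mu> = {x. \<forall>A. open A \<longrightarrow> x \<in> A \<longrightarrow> emeasure \<mu> A > 0}"

definition is_cont_density :: "('a::euclidean_space) measure \<Rightarrow> ('a \<Rightarrow> real) \<Rightarrow> bool" where
  "is_cont_density \<mu> f \<longleftrightarrow>
     continuous_on UNIV f \<and> (\<forall>x. 0 \<le> f x) \<and> \<mu> = density lborel (\<lambda>x. ennreal (f x))"

lemma is_cont_density_unique:
  assumes "is_cont_density \<mu> f" "is_cont_density \<mu> g"
  shows "f = g"
proof -
  have cont: "continuous_on UNIV f" "continuous_on UNIV g"
    using assms by (auto simp: is_cont_density_def)
  then have [measurable]: "f \<in> borel_measurable borel" "g \<in> borel_measurable borel"
    by (auto intro: borel_measurable_continuous_onI)
  have "AE x in lborel. ennreal (f x) = ennreal (g x)"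
    using assms by (intro sigma_finite_measure.density_unique_iff[OF sigma_finite_lborel, THEN iffD1])
      (auto simp: is_cont_density_def)
  then have "AE x in lborel. f x = g x"
    using assms by (auto simp: is_cont_density_def)
  then have null: "emeasure lborel {x. f x \<noteq> g x} = 0"
    by (subst (asm) AE_iff_measurable[OF _ refl]) auto
  have "open {x. f x \<noteq> g x}"
    by (rule open_Collect_neq[OF cont])
  moreover have "negligible {x. f x \<noteq> g x}"
    unfolding negligible_iff_null_sets
    by (rule null_sets_completionI) (use null in \<open>auto intro!: null_setsI\<close>)
  ultimately have "{x. f x \<noteq> g x} = {}"
    using open_not_negligible by blast
  then show ?thesis by auto
qed

definition cont_density :: "('a::euclidean_space) measure \<Rightarrow> 'a \<Rightarrow> real" where
  "cont_density \<mu> = (THE f. is_cont_density \<mu> f)"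

definition D_c :: "('a::euclidean_space) set \<Rightarrow> 'a measure set" where
  "D_c S = {\<mu> \<in> P2. measure_support \<mu> \<subseteq> S \<and> (\<exists>f. is_cont_density \<mu> f)}"

definition modulus_of_continuity :: "(real \<Rightarrow> real) \<Rightarrow> bool" where
  "modulus_of_continuity \<omega> \<longleftrightarrow> mono_on {0..} \<omega> \<and> (\<omega> \<longlongrightarrow> 0) (at_right 0) \<and> \<omega> 0 = 0"

definition density_modulus :: "('a::euclidean_space) set \<Rightarrow> 'a measure \<Rightarrow> real \<Rightarrow> real" where
  "density_modulus S \<mu> t =
     Sup {\<bar>cont_density \<mu> x - cont_density \<mu> y\<bar> | x y. x \<in> S \<and> y \<in> S \<and> norm (x - y) \<le> t}"

text \<open>
  The class of measures whose density modulus is dominated by \<open>\<omega>\<close> on the neighbourhood \<open>U\<close> of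
  \<open>t = 0\<close>. The neighbourhood is a parameter of the class, common to all its members; if it could
  vary with \<open>\<mu>\<close>, then for \<open>\<omega> = sqrt\<close> the class would contain every Lipschitz density and would
  no longer be equicontinuous.
\<close>

definition D_c_mod ::
    "('a::euclidean_space) set \<Rightarrow> (real \<Rightarrow> real) \<Rightarrow> real set \<Rightarrow> 'a measure set" where
  "D_c_mod S \<omega> U = {\<mu> \<in> D_c S. \<forall>t\<in>U. 0 \<le> t \<longrightarrow> density_modulus S \<mu> t \<le> \<omega> t}"


section \<open>Bins\<close>

text \<open>
  The box \<open>cbox a b\<close> is cut into \<open>n ^ d\<close> bins, numbered by \<open>k < n ^ d\<close>: the position of bin \<open>k\<close>
  along coordinate \<open>i\<close> is a digit of \<open>k\<close> in base \<open>n\<close>, the coordinates being numbered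
  \<open>0, \<dots>, d - 1\<close> by \<open>to_nat_on UNIV\<close>.
\<close>

definition bin_digit :: "nat \<Rightarrow> nat \<Rightarrow> 'd::finite \<Rightarrow> nat" where
  "bin_digit n k i = (k div n ^ to_nat_on (UNIV :: 'd set) i) mod n"

definition bin_lower :: "real^'d \<Rightarrow> real^'d \<Rightarrow> nat \<Rightarrow> nat \<Rightarrow> real^'d" where
  "bin_lower a b n k = (\<chi> i. a $ i + real (bin_digit n k i) * ((b $ i - a $ i) / real n))"

definition bin_upper :: "real^'d \<Rightarrow> real^'d \<Rightarrow> nat \<Rightarrow> nat \<Rightarrow> real^'d" where
  "bin_upper a b n k = (\<chi> i. a $ i + (real (bin_digit n k i) + 1) * ((b $ i - a $ i) / real n))"

definition bin :: "real^'d \<Rightarrow> real^'d \<Rightarrow> nat \<Rightarrow> nat \<Rightarrow> (real^'d) set" where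
  "bin a b n k = cbox (bin_lower a b n k) (bin_upper a b n k)"

definition bin_center :: "real^'d \<Rightarrow> real^'d \<Rightarrow> nat \<Rightarrow> nat \<Rightarrow> real^'d" where
  "bin_center a b n k = midpoint (bin_lower a b n k) (bin_upper a b n k)"

definition bin_volume :: "real^'d \<Rightarrow> real^'d \<Rightarrow> nat \<Rightarrow> real" where
  "bin_volume a b n = measure lborel (cbox a b) / real (n ^ CARD('d))"

lemma measure_bin:
  fixes a b :: "real^'d"
  assumes "\<And>i. a $ i < b $ i"
  shows "measure lborel (bin a b n k) = bin_volume a b n"
proof -
  have le: "bin_lower a b n k $ i \<le> bin_upper a b n k $ i" for i
    using assms[of i] by (simp add: bin_lower_def bin_upper_def divide_right_mono)
  have "measure lborel (bin a b n k) =
      (\<Prod>i\<in>UNIV. bin_upper a b n k $ i - bin_lower a b n k $ i)"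
    unfolding bin_def using le by (intro content_cbox_cart) (simp add: interval_ne_empty_cart)
  also have "\<dots> = (\<Prod>i\<in>UNIV. (b $ i - a $ i) / real n)"
    by (intro prod.cong) (simp_all add: bin_lower_def bin_upper_def ring_distribs add_divide_distrib diff_divide_distrib)
  also have "\<dots> = (\<Prod>i\<in>UNIV. b $ i - a $ i) / real (n ^ CARD('d))"
    by (simp add: prod_dividef)
  also have "(\<Prod>i\<in>UNIV. b $ i - a $ i) = measure lborel (cbox a b)"
    using assms by (intro content_cbox_cart[symmetric])
      (auto simp: interval_ne_empty_cart intro: less_imp_le)
  finally show ?thesis by (simp add: bin_volume_def)
qed

definition bin_mass :: "real^'d \<Rightarrow> real^'d \<Rightarrow> nat \<Rightarrow> (real^'d) measure \<Rightarrow> real" where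
  "bin_mass a b n \<mu> =
     (\<Sum>j < n ^ CARD('d). cont_density \<mu> (bin_center a b n j) * bin_volume a b n)"

definition density_bins ::
    "real^'d \<Rightarrow> real^'d \<Rightarrow> nat \<Rightarrow> (real^'d) measure \<Rightarrow> real Matrix.vec" where
  "density_bins a b n \<mu> =
     Matrix.vec (n ^ CARD('d)) (\<lambda>k. cont_density \<mu> (bin_center a b n k) / bin_mass a b n \<mu>)"


section \<open>Neural networks\<close>

text \<open>
  Layer widths vary inside a network, so vectors and matrices are those of
  \<^theory>\<open>Jordan_Normal_Form.Matrix\<close>. A network is given by its nonempty list of affine layers.
\<close>

fun affine_layer :: "real mat \<times> real Matrix.vec \<Rightarrow> real Matrix.vec \<Rightarrow> real Matrix.vec" where
  "affine_layer (W, c) z = W *\<^sub>v z + c"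

fun network_map :: "(real \<Rightarrow> real) \<Rightarrow> (real mat \<times> real Matrix.vec) list
    \<Rightarrow> real Matrix.vec \<Rightarrow> real Matrix.vec" where
  "network_map \<sigma> [] z = z"
| "network_map \<sigma> [A] z = affine_layer A z"
| "network_map \<sigma> (A # B # As) z = network_map \<sigma> (B # As) (map_vec \<sigma> (affine_layer A z))"

fun layers_wf :: "nat \<Rightarrow> (real mat \<times> real Matrix.vec) list \<Rightarrow> nat \<Rightarrow> bool" where
  "layers_wf m [] q \<longleftrightarrow> m = q"
| "layers_wf m ((W, c) # As) q \<longleftrightarrow>
     0 < dim_vec c \<and> W \<in> carrier_mat (dim_vec c) m \<and> layers_wf (dim_vec c) As q"

text \<open>At least two affine layers, that is, at least one hidden layer.\<close>

definition neural_network ::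
    "(real \<Rightarrow> real) \<Rightarrow> nat \<Rightarrow> nat \<Rightarrow> (real Matrix.vec \<Rightarrow> real Matrix.vec) \<Rightarrow> bool" where
  "neural_network \<sigma> m q \<Phi> \<longleftrightarrow>
     (\<exists>As. length As \<ge> 2 \<and> layers_wf m As q \<and> (\<forall>z \<in> carrier_vec m. \<Phi> z = network_map \<sigma> As z))"

definition sigmoid :: "real \<Rightarrow> real" where
  "sigmoid t = 1 / (1 + exp (- t))"

definition relu :: "real \<Rightarrow> real" where
  "relu t = max t 0"

definition to_vec :: "real^'d \<Rightarrow> real Matrix.vec" where
  "to_vec x = Matrix.vec CARD('d) (\<lambda>j. x $ from_nat_into UNIV j)"

definition of_vec :: "real Matrix.vec \<Rightarrow> real^'p" where
  "of_vec v = (\<chi> i. vec_index v (to_nat_on UNIV i))"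

end

theory Submission
  imports Defs "HOL-Complex_Analysis.Great_Picard"
begin

text \<open>
  The densities in the class vanish outside the box and share a modulus of
  continuity, so by Arzela-Ascoli every sequence of them has a uniformly convergent subsequence.
  On a bounded set, uniform convergence of densities implies convergence of the measures in
  \<^const>\<open>W2\<close>: the common part of two densities stays in place, and only the small excess is
  transported. Hence, for every sequence of points \<open>x j\<close> of the box and of measures \<open>\<mu> j\<close> of the
  class, \<open>V (x j) (\<mu> j)\<close> converges along a subsequence (\<open>D_c_mod_sequentially_compact\<close>, \<open>W2_continuous_tendsto\<close>).

  The heart of the proof is \<open>network_inputs_separate\<close>: for some \<open>n\<close> and \<open>\<eta> > 0\<close>, two pairs
  \<open>(x, \<mu>)\<close>, \<open>(y, \<nu>)\<close> whose network inputs are \<open>\<eta>\<close>-close have nearly equal values of \<open>V\<close>. If this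
  failed for \<open>\<eta> = 1/n\<close> and arbitrarily large \<open>n\<close>, a subsequence of counterexamples would have
  densities that converge to \<open>f\<close> and \<open>g\<close> and points with a common limit. The bin centers become
  dense, and the density bins are the values at the centers up to a normalizing factor, so \<open>f\<close> and
  \<open>g\<close> are proportional. Both have integral 1, so \<open>f = g\<close>, and the two values of \<open>V\<close> have the same
  limit, a contradiction. In this way no rate of convergence of Riemann sums enters.

  With such an \<open>n\<close>, each component of \<open>V\<close> is, up to a small error, a function of the network input
  alone, and McShane's extension formula (\<open>Lipschitz_interpolation\<close>) makes it a continuous function
  on the whole input space. The universal approximation theorem \<open>neurons_dense\<close> finishes the proof.
  It follows from the Stone-Weierstrass theorem for the algebra of sums of exponentials of linear
  forms, since the exponential is uniformly close on a bounded interval to a combination of steep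
  sigmoidal steps. The number of inputs depends on \<open>n\<close>, so inputs are represented as functions
  \<open>nat \<Rightarrow> real\<close> that vanish from some index on, with the product topology.
\<close>

section \<open>Couplings of overlapping densities\<close>

text \<open>
  The boolean is a label that selects one of two ways to move mass; once it is integrated out, the
  two contributions add up.
\<close>
lemma nn_integral_pair_bool:
  fixes F :: "(('a \<times> 'a) \<times> bool) \<Rightarrow> ennreal"
  assumes "sigma_finite_measure M"
    and [measurable]: "F \<in> borel_measurable ((M \<Otimes>\<^sub>M M) \<Otimes>\<^sub>M count_space UNIV)"
  shows "(\<integral>\<^sup>+ z. F z \<partial>((M \<Otimes>\<^sub>M M) \<Otimes>\<^sub>M count_space UNIV)) =
         (\<integral>\<^sup>+ x. \<integral>\<^sup>+ y. F ((x, y), True) + F ((x, y), False) \<partial>M \<partial>M)"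
proof -
  interpret M: sigma_finite_measure M by fact
  interpret B: sigma_finite_measure "count_space (UNIV :: bool set)"
    by (rule sigma_finite_measure_count_space_finite) simp
  have "(\<integral>\<^sup>+ z. F z \<partial>((M \<Otimes>\<^sub>M M) \<Otimes>\<^sub>M count_space UNIV)) =
        (\<integral>\<^sup>+ z. \<integral>\<^sup>+ c. F (z, c) \<partial>count_space UNIV \<partial>(M \<Otimes>\<^sub>M M))"
    by (rule B.nn_integral_fst[symmetric]) measurable
  also have "\<dots> = (\<integral>\<^sup>+ z. F (z, True) + F (z, False) \<partial>(M \<Otimes>\<^sub>M M))"
    by (simp add: nn_integral_count_space_finite UNIV_bool add.commute)
  also have "\<dots> = (\<integral>\<^sup>+ x. \<integral>\<^sup>+ y. F ((x, y), True) + F ((x, y), False) \<partial>M \<partial>M)"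
    by (rule M.nn_integral_fst[symmetric]) measurable
  finally show ?thesis .
qed

lemma diagonal_coupling:
  assumes "sets \<mu> = sets borel"
  shows "distr \<mu> borel (\<lambda>x. (x, x)) \<in> couplings \<mu> \<mu>"
proof -
  have [measurable]: "(\<lambda>x. (x, x)) \<in> measurable \<mu> borel"
    by (subst measurable_cong_sets[OF assms refl]) (simp add: borel_prod[symmetric])
  have [measurable]: "(fst :: 'a \<times> 'a \<Rightarrow> 'a) \<in> measurable borel borel"
      "(snd :: 'a \<times> 'a \<Rightarrow> 'a) \<in> measurable borel borel"
    by (simp_all add: borel_prod[symmetric])
  show ?thesis
    by (simp add: couplings_def distr_distr comp_def distr_id2 assms)
qed

text \<open>
  Any single coupling bounds the infimum. The bound must be a real number because
  \<^const>\<open>enn2real\<close> maps \<open>\<infinity>\<close> to \<open>0\<close> and is monotone only below \<open>\<infinity>\<close>.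
\<close>
lemma W2_le_cost:
  assumes "\<pi> \<in> couplings \<mu> \<nu>" "0 \<le> c"
    and "(\<integral>\<^sup>+ z. ennreal ((dist (fst z) (snd z))\<^sup>2) \<partial>\<pi>) \<le> ennreal c"
  shows "W2 \<mu> \<nu> \<le> sqrt c"
proof -
  have "(INF \<pi> \<in> couplings \<mu> \<nu>. \<integral>\<^sup>+ z. ennreal ((dist (fst z) (snd z))\<^sup>2) \<partial>\<pi>) \<le> ennreal c"
    using assms by (intro INF_lower2)
  from enn2real_mono[OF this] assms(2) show ?thesis
    by (simp add: W2_def)
qed

lemma W2_self:
  assumes "sets \<mu> = sets borel"
  shows "W2 \<mu> \<mu> = 0"
proof -
  have [measurable]: "(\<lambda>x. (x, x)) \<in> measurable \<mu> borel"
    by (subst measurable_cong_sets[OF assms refl]) (simp add: borel_prod[symmetric])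
  have m: "(\<lambda>z::'a\<times>'a. ennreal ((dist (fst z) (snd z))\<^sup>2)) \<in> borel_measurable borel"
    by (simp add: borel_prod[symmetric])
  have "W2 \<mu> \<mu> \<le> sqrt 0"
    by (rule W2_le_cost[OF diagonal_coupling[OF assms]]) (simp_all add: nn_integral_distr m)
  moreover have "W2 \<mu> \<mu> \<ge> 0" by (simp add: W2_def)
  ultimately show ?thesis by simp
qed

text \<open>
  A transport plan from the density \<open>u + r\<close> to the density \<open>u + s\<close>: the common part \<open>u\<close> stays in
  place, and the excess \<open>r\<close> is sent to \<open>s\<close> by the product plan, where \<open>\<tau>\<close> is the common mass of \<open>r\<close>
  and \<open>s\<close>. The diagonal part has no density with respect to \<open>lborel \<Otimes>\<^sub>M lborel\<close>, so the plan is the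
  image of a density on a larger space. When the label is \<open>True\<close>, the coordinate \<open>y\<close> is a dummy that
  integrates to 1 against the probability density \<open>u + s\<close>.
\<close>
definition split_coupling ::
    "('a::euclidean_space \<Rightarrow> ennreal) \<Rightarrow> ('a \<Rightarrow> ennreal) \<Rightarrow> ('a \<Rightarrow> ennreal) \<Rightarrow> ennreal
      \<Rightarrow> ('a \<times> 'a) measure" where
  "split_coupling u r s \<tau> =
     distr (density ((lborel \<Otimes>\<^sub>M lborel) \<Otimes>\<^sub>M count_space UNIV)
              (\<lambda>((x, y), c). if c then u x * (u y + s y) else r x * s y / \<tau>))
           borel (\<lambda>((x, y), c). (x, if c then x else y))"

lemma
  fixes u r s :: "'a::euclidean_space \<Rightarrow> ennreal"
  assumes [measurable]: "u \<in> borel_measurable borel" "r \<in> borel_measurable borel"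
      "s \<in> borel_measurable borel"
    and mass: "(\<integral>\<^sup>+ x. u x + s x \<partial>lborel) = 1"
    and r: "(\<integral>\<^sup>+ x. r x \<partial>lborel) = \<tau>" and s: "(\<integral>\<^sup>+ x. s x \<partial>lborel) = \<tau>"
    and \<tau>: "\<tau> \<noteq> 0" "\<tau> \<noteq> \<infinity>"
  shows nn_integral_split_coupling: "\<And>F. F \<in> borel_measurable borel \<Longrightarrow>
      (\<integral>\<^sup>+ z. F z \<partial>split_coupling u r s \<tau>) =
      (\<integral>\<^sup>+ x. u x * F (x, x) \<partial>lborel) +
      (\<integral>\<^sup>+ x. \<integral>\<^sup>+ y. r x * s y / \<tau> * F (x, y) \<partial>lborel \<partial>lborel)"
    and split_coupling: "split_coupling u r s \<tau> \<in>
      couplings (density lborel (\<lambda>x. u x + r x)) (density lborel (\<lambda>x. u x + s x))"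
proof -
  let ?M = "(lborel \<Otimes>\<^sub>M lborel) \<Otimes>\<^sub>M count_space (UNIV::bool set) :: (('a \<times> 'a) \<times> bool) measure"
  have T[measurable]: "(\<lambda>((x, y), c). (x, if c then x else y)) \<in> measurable ?M (borel :: ('a \<times> 'a) measure)"
  proof -
    have [measurable]: "Measurable.pred ?M snd"
      by (rule measurable_snd)
    show ?thesis
      unfolding borel_prod[symmetric] case_prod_beta' by measurable
  qed
  show int: "(\<integral>\<^sup>+ z. F z \<partial>split_coupling u r s \<tau>) =
      (\<integral>\<^sup>+ x. u x * F (x, x) \<partial>lborel) +
      (\<integral>\<^sup>+ x. \<integral>\<^sup>+ y. r x * s y / \<tau> * F (x, y) \<partial>lborel \<partial>lborel)"
    if "F \<in> borel_measurable borel" for F :: "'a \<times> 'a \<Rightarrow> ennreal"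
  proof -
    have [measurable]: "F \<in> borel_measurable (borel \<Otimes>\<^sub>M borel)"
      using that by (simp add: borel_prod)
    have "(\<integral>\<^sup>+ z. F z \<partial>split_coupling u r s \<tau>) =
      (\<integral>\<^sup>+ z. (case z of ((x, y), c) \<Rightarrow> if c then u x * (u y + s y) else r x * s y / \<tau>) *
             F (case z of ((x, y), c) \<Rightarrow> (x, if c then x else y)) \<partial>?M)"
      unfolding split_coupling_def
      by (subst nn_integral_distr, simp add: T, simp add: that, subst nn_integral_density)
         (simp_all add: case_prod_beta')
    also have "\<dots> = (\<integral>\<^sup>+ x. \<integral>\<^sup>+ y. u x * F (x, x) * (u y + s y) + r x * s y / \<tau> * F (x, y) \<partial>lborel \<partial>lborel)"
      by (subst nn_integral_pair_bool[OF sigma_finite_lborel]) (simp_all add: mult_ac)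
    also have "\<dots> = (\<integral>\<^sup>+ x. u x * F (x, x) * (\<integral>\<^sup>+ y. u y + s y \<partial>lborel) +
          (\<integral>\<^sup>+ y. r x * s y / \<tau> * F (x, y) \<partial>lborel) \<partial>lborel)"
      by (subst nn_integral_add, simp, simp, subst nn_integral_cmult, simp_all)
    also have "\<dots> = (\<integral>\<^sup>+ x. u x * F (x, x) \<partial>lborel) +
      (\<integral>\<^sup>+ x. \<integral>\<^sup>+ y. r x * s y / \<tau> * F (x, y) \<partial>lborel \<partial>lborel)"
      unfolding mass by (subst nn_integral_add) simp_all
    finally show ?thesis .
  qed
  have sets: "sets (split_coupling u r s \<tau>) = sets borel"
    by (simp add: split_coupling_def)
  have m: "fst \<in> measurable (split_coupling u r s \<tau>) borel" "snd \<in> measurable (split_coupling u r s \<tau>) borel"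
    unfolding measurable_cong_sets[OF sets refl] by (simp_all add: borel_prod[symmetric])
  have ind: "(\<lambda>z::'a\<times>'a. indicator A (fst z) :: ennreal) \<in> borel_measurable borel"
      "(\<lambda>z::'a\<times>'a. indicator A (snd z) :: ennreal) \<in> borel_measurable borel"
    if "A \<in> sets borel" for A
    using that by (simp_all add: borel_prod[symmetric])
  have \<tau>\<tau>: "\<tau> / \<tau> = 1"
    using \<tau> by (simp add: ennreal_divide_self less_top)
  have e1: "emeasure (distr (split_coupling u r s \<tau>) borel fst) A = emeasure (density lborel (\<lambda>x. u x + r x)) A"
    if A[measurable]: "A \<in> sets borel" for A
  proof -
    have "emeasure (distr (split_coupling u r s \<tau>) borel fst) A
        = (\<integral>\<^sup>+ z. indicator A (fst z) \<partial>split_coupling u r s \<tau>)"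
      using that m by (subst nn_integral_indicator[symmetric], simp, subst nn_integral_distr) simp_all
    also have "\<dots> = (\<integral>\<^sup>+ x. u x * indicator A x \<partial>lborel) +
      (\<integral>\<^sup>+ x. \<integral>\<^sup>+ y. (r x * indicator A x / \<tau>) * s y \<partial>lborel \<partial>lborel)"
      by (subst int[OF ind(1)[OF A]]) (simp add: divide_ennreal_def mult_ac)
    also have "\<dots> = (\<integral>\<^sup>+ x. u x * indicator A x \<partial>lborel) + (\<integral>\<^sup>+ x. r x * indicator A x \<partial>lborel)"
      using \<tau> by (simp add: nn_integral_cmult nn_integral_multc nn_integral_divide s
          ennreal_divide_times \<tau>\<tau>)
    also have "\<dots> = emeasure (density lborel (\<lambda>x. u x + r x)) A"
      by (subst nn_integral_add[symmetric], simp, simp, subst emeasure_density)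
         (simp_all add: distrib_right)
    finally show ?thesis .
  qed
  have e2: "emeasure (distr (split_coupling u r s \<tau>) borel snd) A = emeasure (density lborel (\<lambda>x. u x + s x)) A"
    if A[measurable]: "A \<in> sets borel" for A
  proof -
    have "emeasure (distr (split_coupling u r s \<tau>) borel snd) A
        = (\<integral>\<^sup>+ z. indicator A (snd z) \<partial>split_coupling u r s \<tau>)"
      using that m by (subst nn_integral_indicator[symmetric], simp, subst nn_integral_distr) simp_all
    also have "\<dots> = (\<integral>\<^sup>+ x. u x * indicator A x \<partial>lborel) +
      (\<integral>\<^sup>+ x. \<integral>\<^sup>+ y. (r x / \<tau>) * (s y * indicator A y) \<partial>lborel \<partial>lborel)"
      by (subst int[OF ind(2)[OF A]]) (simp add: divide_ennreal_def mult_ac)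
    also have "\<dots> = (\<integral>\<^sup>+ x. u x * indicator A x \<partial>lborel) + (\<integral>\<^sup>+ x. s x * indicator A x \<partial>lborel)"
      using \<tau> by (simp add: nn_integral_cmult nn_integral_multc nn_integral_divide r less_top ennreal_divide_self)
    also have "\<dots> = emeasure (density lborel (\<lambda>x. u x + s x)) A"
      by (subst nn_integral_add[symmetric], simp, simp, subst emeasure_density)
         (simp_all add: distrib_right)
    finally show ?thesis .
  qed
  show "split_coupling u r s \<tau> \<in>
      couplings (density lborel (\<lambda>x. u x + r x)) (density lborel (\<lambda>x. u x + s x))"
    unfolding couplings_def using sets e1 e2 by (auto intro!: measure_eqI)
qed

text \<open>
  The plan \<^const>\<open>split_coupling\<close> with \<open>u = min f g\<close> moves only the mass of \<open>f - min f g\<close>, which is at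
  most \<open>\<delta>\<close> times the volume of \<open>S\<close>, and moves it by at most \<open>R\<close>.
\<close>
lemma W2_density_le:
  fixes f g :: "'a::euclidean_space \<Rightarrow> real"
  assumes [measurable]: "f \<in> borel_measurable borel" "g \<in> borel_measurable borel"
    and nonneg: "\<And>x. 0 \<le> f x" "\<And>x. 0 \<le> g x"
    and mass: "(\<integral>\<^sup>+ x. ennreal (f x) \<partial>lborel) = 1" "(\<integral>\<^sup>+ x. ennreal (g x) \<partial>lborel) = 1"
    and S[measurable]: "S \<in> sets borel" and finS: "emeasure lborel S < \<infinity>"
    and off: "\<And>x. x \<notin> S \<Longrightarrow> f x = 0" "\<And>x. x \<notin> S \<Longrightarrow> g x = 0"
    and R: "\<And>x y. x \<in> S \<Longrightarrow> y \<in> S \<Longrightarrow> dist x y \<le> R" "0 \<le> R"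
    and \<delta>: "\<And>x. x \<in> S \<Longrightarrow> \<bar>f x - g x\<bar> \<le> \<delta>" "0 \<le> \<delta>"
  shows "W2 (density lborel (\<lambda>x. ennreal (f x))) (density lborel (\<lambda>x. ennreal (g x)))
      \<le> sqrt (R\<^sup>2 * (\<delta> * measure lborel S))"
proof -
  define u where "u x = ennreal (min (f x) (g x))" for x
  define r where "r x = ennreal (f x - min (f x) (g x))" for x
  define s where "s x = ennreal (g x - min (f x) (g x))" for x
  have [measurable]: "u \<in> borel_measurable borel" "r \<in> borel_measurable borel"
      "s \<in> borel_measurable borel"
    unfolding u_def r_def s_def by measurable
  have ur: "u x + r x = ennreal (f x)" "u x + s x = ennreal (g x)" for x
    unfolding u_def r_def s_def using nonneg[of x] by (subst ennreal_plus[symmetric]; simp)+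
  define \<tau> where "\<tau> = (\<integral>\<^sup>+ x. r x \<partial>lborel)"
  have sum: "(\<integral>\<^sup>+ x. u x \<partial>lborel) + \<tau> = 1" "(\<integral>\<^sup>+ x. u x \<partial>lborel) + (\<integral>\<^sup>+ x. s x \<partial>lborel) = 1"
    unfolding \<tau>_def using mass by (simp_all add: nn_integral_add[symmetric] ur)
  then have "(\<integral>\<^sup>+ x. u x \<partial>lborel) \<noteq> \<top>" by auto
  then have \<tau>s: "(\<integral>\<^sup>+ x. s x \<partial>lborel) = \<tau>"
    using sum by (metis ennreal_add_left_cancel infinity_ennreal_def)
  have \<tau>fin: "\<tau> \<noteq> \<infinity>" using sum(1) by auto
  have dens: "density lborel (\<lambda>x. u x + r x) = density lborel (\<lambda>x. ennreal (f x))"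
       "density lborel (\<lambda>x. u x + s x) = density lborel (\<lambda>x. ennreal (g x))"
    by (simp_all add: ur)
  show ?thesis
  \<comment> \<open>if no mass has to move, the normalization by \<open>\<tau>\<close> is meaningless, but the measures coincide\<close>
  proof (cases "\<tau> = 0")
    case True
    then have "AE x in lborel. r x = 0"
      by (simp add: \<tau>_def nn_integral_0_iff_AE)
    moreover have "AE x in lborel. s x = 0"
      using True \<tau>s by (simp add: nn_integral_0_iff_AE)
    ultimately have "AE x in lborel. ennreal (f x) = ennreal (g x)"
      by eventually_elim (metis ur)
    then have "density lborel (\<lambda>x. ennreal (f x)) = density lborel (\<lambda>x. ennreal (g x))"
      by (intro density_cong) auto
    then show ?thesis
      using \<delta> by (simp add: W2_self)
  next
    case False
    have "(\<integral>\<^sup>+ z. ennreal ((dist (fst z) (snd z))\<^sup>2) \<partial>split_coupling u r s \<tau>) =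
        (\<integral>\<^sup>+ x. \<integral>\<^sup>+ y. r x * s y / \<tau> * ennreal ((dist x y)\<^sup>2) \<partial>lborel \<partial>lborel)"
      by (subst nn_integral_split_coupling)
         (use False \<tau>fin \<tau>s mass(2) in \<open>simp_all add: ur \<tau>_def borel_prod[symmetric]\<close>)
    also have "\<dots> \<le> (\<integral>\<^sup>+ x. \<integral>\<^sup>+ y. (ennreal (R\<^sup>2) * r x / \<tau>) * s y \<partial>lborel \<partial>lborel)"
    proof (intro nn_integral_mono)
      fix x y :: 'a
      show "r x * s y / \<tau> * ennreal ((dist x y)\<^sup>2) \<le> (ennreal (R\<^sup>2) * r x / \<tau>) * s y"
      proof (cases "x \<in> S \<and> y \<in> S")
        case True
        then have "ennreal ((dist x y)\<^sup>2) \<le> ennreal (R\<^sup>2)"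
          using R by (intro ennreal_leI power_mono) auto
        then have "r x * s y / \<tau> * ennreal ((dist x y)\<^sup>2) \<le> r x * s y / \<tau> * ennreal (R\<^sup>2)"
          by (intro mult_left_mono) auto
        then show ?thesis by (simp add: divide_ennreal_def mult_ac)
      next
        case False
        then have "r x = 0 \<or> s y = 0" using off by (auto simp: r_def s_def)
        then show ?thesis by auto
      qed
    qed
    also have "\<dots> = ennreal (R\<^sup>2) * \<tau>"
    proof -
      have "\<tau> / \<tau> = 1" using False \<tau>fin by (simp add: ennreal_divide_self less_top)
      then show ?thesis
        by (simp add: nn_integral_cmult nn_integral_multc nn_integral_divide \<tau>s
              ennreal_divide_times \<tau>_def[symmetric] mult.assoc ennreal_times_divide[symmetric])
    qed
    also have "\<tau> \<le> (\<integral>\<^sup>+ x. ennreal \<delta> * indicator S x \<partial>lborel)"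
      unfolding \<tau>_def
    proof (intro nn_integral_mono)
      fix x
      show "r x \<le> ennreal \<delta> * indicator S x"
        using off[of x] \<delta>(1)[of x] \<delta>(2)
        by (cases "x \<in> S") (auto simp: r_def min_def intro!: ennreal_leI)
    qed
    also have "(\<integral>\<^sup>+ x. ennreal \<delta> * indicator S x \<partial>lborel) = ennreal (\<delta> * measure lborel S)"
      using finS \<delta> by (simp add: nn_integral_cmult_indicator emeasure_eq_ennreal_measure ennreal_mult less_top)
    also have "ennreal (R\<^sup>2) * ennreal (\<delta> * measure lborel S) = ennreal (R\<^sup>2 * (\<delta> * measure lborel S))"
      using \<delta> by (simp add: ennreal_mult)
    finally have cost: "(\<integral>\<^sup>+ z. ennreal ((dist (fst z) (snd z))\<^sup>2) \<partial>split_coupling u r s \<tau>)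
        \<le> ennreal (R\<^sup>2 * (\<delta> * measure lborel S))"
      by (simp add: mult_left_mono)
    have "split_coupling u r s \<tau> \<in>
        couplings (density lborel (\<lambda>x. ennreal (f x))) (density lborel (\<lambda>x. ennreal (g x)))"
      unfolding dens[symmetric]
      by (rule split_coupling) (use False \<tau>fin \<tau>s mass(2) in \<open>simp_all add: ur \<tau>_def\<close>)
    then show ?thesis
      by (rule W2_le_cost) (use cost \<delta> in auto)
  qed
qed

section \<open>Densities with a common modulus of continuity\<close>

lemma cont_density:
  assumes "\<mu> \<in> D_c S"
  shows "is_cont_density \<mu> (cont_density \<mu>)"
proof -
  obtain f where "is_cont_density \<mu> f" using assms by (auto simp: D_c_def)
  then show ?thesis
    unfolding cont_density_def
    using theI[of "is_cont_density \<mu>" f] is_cont_density_unique by blast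
qed

lemma
  assumes "\<mu> \<in> D_c S"
  shows continuous_cont_density: "continuous_on UNIV (cont_density \<mu>)"
    and cont_density_nonneg: "0 \<le> cont_density \<mu> x"
    and density_cont_density: "density lborel (\<lambda>x. ennreal (cont_density \<mu> x)) = \<mu>"
    and nn_integral_cont_density: "(\<integral>\<^sup>+ x. ennreal (cont_density \<mu> x) \<partial>lborel) = 1"
proof -
  show c: "continuous_on UNIV (cont_density \<mu>)"
    and "0 \<le> cont_density \<mu> x"
    and d: "density lborel (\<lambda>x. ennreal (cont_density \<mu> x)) = \<mu>"
    using cont_density[OF assms] by (auto simp: is_cont_density_def)
  have [measurable]: "cont_density \<mu> \<in> borel_measurable borel"
    using c by (rule borel_measurable_continuous_onI)
  have "prob_space \<mu>" using assms by (auto simp: D_c_def P2_def)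
  from prob_space.emeasure_space_1[OF this]
  show "(\<integral>\<^sup>+ x. ennreal (cont_density \<mu> x) \<partial>lborel) = 1"
    by (subst (asm) (1 2) d[symmetric]) (simp add: emeasure_density)
qed

text \<open>
  A point outside the support has a neighborhood of measure zero, where the density vanishes almost
  everywhere; the set where a continuous density is nonzero is open, and a nonempty open set is not
  negligible.
\<close>
lemma cont_density_zero_outside:
  assumes \<mu>: "\<mu> \<in> D_c S" and x: "x \<notin> S"
  shows "cont_density \<mu> x = 0"
proof -
  let ?f = "cont_density \<mu>"
  have cont: "continuous_on UNIV ?f" by (rule continuous_cont_density[OF \<mu>])
  then have [measurable]: "?f \<in> borel_measurable borel" by (rule borel_measurable_continuous_onI)
  have "x \<notin> measure_support \<mu>" using assms by (auto simp: D_c_def)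
  then obtain A where A: "open A" "x \<in> A" "emeasure \<mu> A = 0"
    by (auto simp: measure_support_def)
  have [measurable]: "A \<in> sets borel" using A by auto
  have "emeasure (density lborel (\<lambda>x. ennreal (?f x))) A = 0"
    using A by (simp add: density_cont_density[OF \<mu>])
  then have "AE x in lborel. ennreal (?f x) * indicator A x = 0"
    by (simp add: emeasure_density nn_integral_0_iff_AE)
  then have "AE x in lborel. x \<notin> A \<inter> {x. ?f x \<noteq> 0}"
    by eventually_elim (use cont_density_nonneg[OF \<mu>] in
        \<open>auto simp: indicator_def ennreal_eq_0_iff intro: antisym split: if_splits\<close>)
  then have "emeasure lborel (A \<inter> {x. ?f x \<noteq> 0}) = 0"
    by (subst (asm) AE_iff_measurable[OF _ refl]) (auto simp: Int_def)
  then have "negligible (A \<inter> {x. ?f x \<noteq> 0})"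
    unfolding negligible_iff_null_sets by (intro null_sets_completionI null_setsI) auto
  moreover have "open (A \<inter> {x. ?f x \<noteq> 0})"
    by (intro open_Int A open_Collect_neq cont continuous_on_const)
  ultimately have "A \<inter> {x. ?f x \<noteq> 0} = {}" using open_not_negligible by blast
  with A show ?thesis by auto
qed

text \<open>
  All members of the class obey the bound \<open>\<omega>\<close> on the same neighborhood \<open>U\<close> of \<open>0\<close>; this is what
  makes \<open>d\<close> independent of the measure.
\<close>
lemma D_c_mod_equicontinuous:
  fixes S :: "'a::euclidean_space set"
  assumes "compact S" "modulus_of_continuity \<omega>" "open U" "0 \<in> U" "e > 0"
  obtains d where "d > 0"
    "\<And>\<mu> x y. \<mu> \<in> D_c_mod S \<omega> U \<Longrightarrow> x \<in> S \<Longrightarrow> y \<in> S \<Longrightarrow> norm (x - y) < d \<Longrightarrow>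
        \<bar>cont_density \<mu> x - cont_density \<mu> y\<bar> < e"
proof -
  have "eventually (\<lambda>t. \<omega> t < e) (at_right 0)"
    using assms by (auto simp: modulus_of_continuity_def intro: order_tendstoD)
  then obtain d1 where d1: "d1 > 0" "\<And>t. 0 < t \<Longrightarrow> t < d1 \<Longrightarrow> \<omega> t < e"
    by (auto simp: eventually_at_right_field)
  obtain d2 where d2: "d2 > 0" "ball 0 d2 \<subseteq> U"
    using assms openE by blast
  show ?thesis
  proof
    show "min d1 d2 > 0" using d1 d2 by simp
    fix \<mu> x y assume \<mu>: "\<mu> \<in> D_c_mod S \<omega> U" and xy: "x \<in> S" "y \<in> S" "norm (x - y) < min d1 d2"
    let ?f = "cont_density \<mu>" and ?t = "norm (x - y)"
    have \<mu>D: "\<mu> \<in> D_c S" using \<mu> by (auto simp: D_c_mod_def)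
    show "\<bar>?f x - ?f y\<bar> < e"
    proof (cases "x = y")
      case False
      have "bounded (?f ` S)"
        using continuous_on_subset[OF continuous_cont_density[OF \<mu>D]] assms(1)
        by (intro compact_imp_bounded compact_continuous_image) auto
      then obtain B where B: "\<And>z. z \<in> S \<Longrightarrow> \<bar>?f z\<bar> \<le> B"
        unfolding bounded_iff by auto
      have "\<bar>?f x - ?f y\<bar> \<le> density_modulus S \<mu> ?t"
        unfolding density_modulus_def
      proof (rule cSup_upper)
        show "bdd_above {\<bar>?f x - ?f y\<bar> | x y. x \<in> S \<and> y \<in> S \<and> norm (x - y) \<le> ?t}"
        proof (rule bdd_aboveI[of _ "2 * B"], clarify)
          fix p q assume "p \<in> S" "q \<in> S"
          with B[of p] B[of q] show "\<bar>?f p - ?f q\<bar> \<le> 2 * B" by linarith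
        qed
      qed (use xy in blast)
      also have "?t \<in> U" using d2(2) xy by (auto simp: subset_iff)
      then have "density_modulus S \<mu> ?t \<le> \<omega> ?t" using \<mu> by (auto simp: D_c_mod_def)
      also have "\<omega> ?t < e" using d1(2) xy False by auto
      finally show ?thesis .
    qed (use assms in simp)
  qed
qed

text \<open>
  Equicontinuity allows the point of evaluation to move along with the density.
\<close>
lemma D_c_mod_tendsto_along:
  fixes S :: "'a::euclidean_space set"
  assumes "compact S" "modulus_of_continuity \<omega>" "open U" "0 \<in> U"
    and \<rho>: "\<And>j::nat. \<rho> j \<in> D_c_mod S \<omega> U" and c: "\<And>j. c j \<in> S" and z: "z \<in> S"
    and c_lim: "(\<lambda>j. c j) \<longlonglongrightarrow> z"
    and l: "(\<lambda>j. cont_density (\<rho> j) z) \<longlonglongrightarrow> l"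
  shows "(\<lambda>j. cont_density (\<rho> j) (c j)) \<longlonglongrightarrow> l"
proof -
  have "(\<lambda>j. cont_density (\<rho> j) (c j) - cont_density (\<rho> j) z) \<longlonglongrightarrow> 0"
  proof (rule LIMSEQ_I)
    fix e :: real assume "0 < e"
    obtain d where d: "d > 0"
      "\<And>\<mu> x y. \<mu> \<in> D_c_mod S \<omega> U \<Longrightarrow> x \<in> S \<Longrightarrow> y \<in> S \<Longrightarrow> norm (x - y) < d \<Longrightarrow>
          \<bar>cont_density \<mu> x - cont_density \<mu> y\<bar> < e"
      using D_c_mod_equicontinuous[OF assms(1-4) \<open>0 < e\<close>] by blast
    obtain J where "\<And>j. j \<ge> J \<Longrightarrow> norm (c j - z) < d"
      using LIMSEQ_D[OF c_lim d(1)] by blast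
    then show "\<exists>no. \<forall>j\<ge>no. norm (cont_density (\<rho> j) (c j) - cont_density (\<rho> j) z - 0) < e"
      using d(2)[OF \<rho> c z] by auto
  qed
  from tendsto_add[OF this l] show ?thesis by simp
qed

text \<open>
  The density is continuous and vanishes outside the box, so it vanishes at the corner \<open>a\<close>. Any
  point of the box is reached from \<open>a\<close> along a segment in a fixed number \<open>N\<close> of short steps, each of
  which changes the density by less than 1.
\<close>
lemma D_c_mod_uniformly_bounded:
  fixes a b :: "real^'d"
  assumes ab: "\<And>i. a $ i < b $ i"
    and "modulus_of_continuity \<omega>" "open U" "0 \<in> U"
  obtains M where "0 < M" "\<And>\<mu> x. \<mu> \<in> D_c_mod (cbox a b) \<omega> U \<Longrightarrow> cont_density \<mu> x \<le> M"
proof -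
  obtain d where d: "d > 0"
    "\<And>\<mu> x y. \<mu> \<in> D_c_mod (cbox a b) \<omega> U \<Longrightarrow> x \<in> cbox a b \<Longrightarrow> y \<in> cbox a b \<Longrightarrow> norm (x - y) < d \<Longrightarrow>
        \<bar>cont_density \<mu> x - cont_density \<mu> y\<bar> < 1"
    using D_c_mod_equicontinuous[OF compact_cbox assms(2-4), of 1] by auto
  obtain N :: nat where "norm (b - a) / d < N" using reals_Archimedean2 by blast
  then have N: "norm (b - a) < N * d" using d by (simp add: field_simps)
  then have "0 < real N * d" by (smt (verit) norm_ge_zero)
  then have Npos: "N > 0" using d by (auto simp: zero_less_mult_iff)
  have a_in: "a \<in> cbox a b" using ab by (auto simp: mem_box_cart less_imp_le)
  show ?thesis
  proof
    show "0 < real N" using Npos by simp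
    fix \<mu> x assume \<mu>: "\<mu> \<in> D_c_mod (cbox a b) \<omega> U"
    let ?f = "cont_density \<mu>"
    have \<mu>D: "\<mu> \<in> D_c (cbox a b)" using \<mu> by (auto simp: D_c_mod_def)
    have fa: "?f a = 0"
    proof -
      have "closed {x. ?f x = 0}"
        by (intro closed_Collect_eq continuous_cont_density[OF \<mu>D] continuous_on_const)
      moreover have "- cbox a b \<subseteq> {x. ?f x = 0}"
        using cont_density_zero_outside[OF \<mu>D] by auto
      ultimately have "closure (- cbox a b) \<subseteq> {x. ?f x = 0}" by (rule closure_minimal[rotated])
      moreover have "a \<in> closure (- cbox a b)"
        by (auto simp: closure_interior interior_cbox mem_box_cart)
      ultimately show ?thesis by auto
    qed
    show "?f x \<le> real N"
    proof (cases "x \<in> cbox a b")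
      case True
      define p where "p k = a + (real k / real N) *\<^sub>R (x - a)" for k
      have p_in: "p k \<in> cbox a b" if "k \<le> N" for k
      proof -
        have "(1 - real k / real N) *\<^sub>R a + (real k / real N) *\<^sub>R x \<in> cbox a b"
          using that Npos by (intro convexD[OF convex_box(1)] a_in True) auto
        then show ?thesis by (simp add: p_def algebra_simps)
      qed
      have xa: "norm (x - a) \<le> norm (b - a)"
        by (rule norm_le_componentwise_cart) (use True ab in \<open>auto simp: mem_box_cart less_imp_le\<close>)
      have step: "norm (p (Suc k) - p k) < d" for k
      proof -
        have "p (Suc k) - p k = (1 / real N) *\<^sub>R (x - a)"
          by (simp add: p_def add_divide_distrib scaleR_left_distrib)
        then have "norm (p (Suc k) - p k) = norm (x - a) / N" by simp
        also have "\<dots> \<le> norm (b - a) / N" using xa by (intro divide_right_mono) auto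
        also have "\<dots> < d" using N Npos by (simp add: field_simps)
        finally show ?thesis .
      qed
      have "k \<le> N \<Longrightarrow> ?f (p k) \<le> real k" for k
      proof (induction k)
        case 0
        then show ?case using fa by (simp add: p_def)
      next
        case (Suc k)
        then have "\<bar>?f (p (Suc k)) - ?f (p k)\<bar> < 1"
          by (intro d(2)[OF \<mu>] p_in step) auto
        with Suc show ?case by simp
      qed
      from this[of N] show ?thesis using Npos by (simp add: p_def)
    qed (use cont_density_zero_outside[OF \<mu>D] in simp)
  qed
qed

section \<open>Sequential compactness and the Wasserstein distance\<close>

lemma density_bounded_support_in_P2:
  fixes f :: "'a::euclidean_space \<Rightarrow> real"
  assumes [measurable]: "f \<in> borel_measurable borel"
    and mass: "(\<integral>\<^sup>+ x. ennreal (f x) \<partial>lborel) = 1"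
    and S: "bounded S" and off: "\<And>x. x \<notin> S \<Longrightarrow> f x = 0"
  shows "density lborel (\<lambda>x. ennreal (f x)) \<in> P2"
proof -
  let ?\<mu> = "density lborel (\<lambda>x. ennreal (f x))"
  interpret prob_space ?\<mu>
    by (rule prob_spaceI) (simp add: emeasure_density mass)
  obtain B where B: "\<And>x. x \<in> S \<Longrightarrow> norm x \<le> B" using S by (auto simp: bounded_iff)
  have "AE x in ?\<mu>. norm ((norm x)\<^sup>2) \<le> B\<^sup>2"
    by (subst AE_density, simp, rule AE_I2) (use off B in \<open>force intro!: power_mono\<close>)
  then have "integrable ?\<mu> (\<lambda>x. (norm x)\<^sup>2)"
    by (rule integrable_const_bound) measurable
  with prob_space_axioms show ?thesis by (simp add: P2_def)
qed

text \<open>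
  Arzela-Ascoli gives a uniform limit on the box. Dominated convergence preserves the total mass,
  and \<open>W2_density_le\<close> turns uniform convergence into convergence in \<^const>\<open>W2\<close>. The limit is only
  claimed to be a measure in \<^const>\<open>P2\<close>, which is where the continuity of \<open>V\<close> is available.
\<close>
theorem D_c_mod_sequentially_compact:
  fixes a b :: "real^'d"
  assumes ab: "\<And>i. a $ i < b $ i"
    and mod: "modulus_of_continuity \<omega>" "open U" "0 \<in> U"
    and \<mu>: "\<And>n. \<mu> n \<in> D_c_mod (cbox a b) \<omega> U"
  obtains r f where "strict_mono (r :: nat \<Rightarrow> nat)"
    "\<And>x. (\<lambda>n. cont_density (\<mu> (r n)) x) \<longlonglongrightarrow> f x" "f \<in> borel_measurable borel"
    "\<And>x. x \<notin> cbox a b \<Longrightarrow> f x = 0" "\<And>x. 0 \<le> f x" "(\<integral>\<^sup>+ x. ennreal (f x) \<partial>lborel) = 1"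
    "density lborel (\<lambda>x. ennreal (f x)) \<in> P2"
    "(\<lambda>n. W2 (density lborel (\<lambda>x. ennreal (f x))) (\<mu> (r n))) \<longlonglongrightarrow> 0"
proof -
  let ?S = "cbox a b"
  have D: "\<mu> n \<in> D_c ?S" for n using \<mu> by (auto simp: D_c_mod_def)
  obtain M where M: "0 < M" "\<And>n x. cont_density (\<mu> n) x \<le> M"
    using D_c_mod_uniformly_bounded[OF ab mod] \<mu> by metis
  obtain g r where g: "continuous_on ?S g" and r: "strict_mono (r :: nat \<Rightarrow> nat)"
    and unif: "\<And>e. 0 < e \<Longrightarrow>
      \<exists>N. \<forall>n x. n \<ge> N \<and> x \<in> ?S \<longrightarrow> norm (cont_density (\<mu> (r n)) x - g x) < e"
  proof (rule Arzela_Ascoli[of ?S "\<lambda>n. cont_density (\<mu> n)" M])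
    show "norm (cont_density (\<mu> n) x) \<le> M" for n x
      using M cont_density_nonneg[OF D] by simp
    show "\<exists>d>0. \<forall>n y. y \<in> ?S \<and> norm (x - y) < d \<longrightarrow>
        norm (cont_density (\<mu> n) x - cont_density (\<mu> n) y) < e" if "x \<in> ?S" "0 < e" for x e
      using D_c_mod_equicontinuous[OF compact_cbox mod \<open>0 < e\<close>, of a b] \<mu> that
      by (metis real_norm_def)
  qed auto
  define f where "f x = (if x \<in> ?S then g x else 0)" for x
  have off: "f x = 0" if "x \<notin> ?S" for x using that by (simp add: f_def)
  have lim: "(\<lambda>n. cont_density (\<mu> (r n)) x) \<longlonglongrightarrow> f x" for x
  proof (cases "x \<in> ?S")
    case True
    then show ?thesis unfolding LIMSEQ_iff f_def using unif by simp blast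
  next
    case False
    then show ?thesis using cont_density_zero_outside[OF D False] by (simp add: f_def)
  qed
  have meas[measurable]: "cont_density (\<mu> n) \<in> borel_measurable borel" for n
    by (intro borel_measurable_continuous_onI continuous_cont_density[OF D])
  have f_meas[measurable]: "f \<in> borel_measurable borel"
    by (rule borel_measurable_LIMSEQ_real[OF lim]) measurable
  have f0: "0 \<le> f x" for x
    by (rule LIMSEQ_le_const[OF lim]) (use cont_density_nonneg[OF D] in auto)
  have finS: "emeasure lborel ?S < \<infinity>" using emeasure_lborel_cbox_finite by (auto simp: less_top)
  have mass: "(\<integral>\<^sup>+ x. ennreal (f x) \<partial>lborel) = 1"
  proof -
    have "(\<lambda>n. \<integral>\<^sup>+ x. ennreal (cont_density (\<mu> (r n)) x) \<partial>lborel) \<longlonglongrightarrow> (\<integral>\<^sup>+ x. ennreal (f x) \<partial>lborel)"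
    proof (rule nn_integral_dominated_convergence[where w="\<lambda>x. ennreal M * indicator ?S x"])
      show "AE x in lborel. ennreal (cont_density (\<mu> (r n)) x) \<le> ennreal M * indicator ?S x" for n
        using M cont_density_zero_outside[OF D]
        by (intro AE_I2) (auto simp: indicator_def intro!: ennreal_leI)
      show "(\<integral>\<^sup>+ x. ennreal M * indicator ?S x \<partial>lborel) < \<infinity>"
        using finS by (simp add: nn_integral_cmult_indicator ennreal_mult_less_top)
      show "AE x in lborel. (\<lambda>n. ennreal (cont_density (\<mu> (r n)) x)) \<longlonglongrightarrow> ennreal (f x)"
        by (intro AE_I2 tendsto_ennrealI lim)
    qed measurable
    then show ?thesis
      unfolding nn_integral_cont_density[OF D] by (simp add: LIMSEQ_const_iff)
  qed
  define R where "R = norm (b - a)"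
  define L where "L = measure lborel ?S"
  have dist: "dist x y \<le> R" if "x \<in> ?S" "y \<in> ?S" for x y
    unfolding R_def dist_norm
  proof (rule norm_le_componentwise_cart)
    fix i
    show "norm ((x - y) $ i) \<le> norm ((b - a) $ i)"
      using that[unfolded mem_box_cart, rule_format, of i] by auto
  qed
  have W2: "(\<lambda>n. W2 (density lborel (\<lambda>x. ennreal (f x))) (\<mu> (r n))) \<longlonglongrightarrow> 0"
  proof (rule LIMSEQ_I)
    fix e :: real assume "0 < e"
    \<comment> \<open>the summand 1 keeps the denominator positive\<close>
    define \<delta> where "\<delta> = (e / 2)\<^sup>2 / (R\<^sup>2 * L + 1)"
    have RL: "R\<^sup>2 * L \<ge> 0" by (simp add: L_def)
    then have \<delta>: "\<delta> > 0" unfolding \<delta>_def using \<open>0 < e\<close> by (intro divide_pos_pos) auto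
    obtain N where N: "\<forall>n x. n \<ge> N \<and> x \<in> ?S \<longrightarrow> norm (cont_density (\<mu> (r n)) x - g x) < \<delta>"
      using unif[OF \<delta>] by blast
    have "norm (W2 (density lborel (\<lambda>x. ennreal (f x))) (\<mu> (r n)) - 0) < e" if "n \<ge> N" for n
    proof -
      have "W2 (density lborel (\<lambda>x. ennreal (f x)))
          (density lborel (\<lambda>x. ennreal (cont_density (\<mu> (r n)) x))) \<le> sqrt (R\<^sup>2 * (\<delta> * L))"
        unfolding L_def
      proof (rule W2_density_le)
        show "\<bar>f x - cont_density (\<mu> (r n)) x\<bar> \<le> \<delta>" if "x \<in> ?S" for x
          using N[rule_format, of n x] \<open>n \<ge> N\<close> that by (simp add: f_def abs_minus_commute)
      qed (use finS f0 cont_density_nonneg[OF D] off cont_density_zero_outside[OF D] mass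
              nn_integral_cont_density[OF D] dist \<delta> in \<open>auto simp: R_def\<close>)
      also have "\<dots> \<le> sqrt ((e / 2)\<^sup>2)"
      proof (rule real_sqrt_le_mono)
        have "R\<^sup>2 * (\<delta> * L) = (e / 2)\<^sup>2 * ((R\<^sup>2 * L) / (R\<^sup>2 * L + 1))"
          by (simp add: \<delta>_def)
        also have "\<dots> \<le> (e / 2)\<^sup>2 * 1" using RL by (intro mult_left_mono) auto
        finally show "R\<^sup>2 * (\<delta> * L) \<le> (e / 2)\<^sup>2" by simp
      qed
      also have "\<dots> < e" using \<open>0 < e\<close> by simp
      finally have "W2 (density lborel (\<lambda>x. ennreal (f x))) (\<mu> (r n)) < e"
        by (simp add: density_cont_density[OF D])
      moreover have "0 \<le> W2 (density lborel (\<lambda>x. ennreal (f x))) (\<mu> (r n))"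
        by (simp add: W2_def)
      ultimately show ?thesis by simp
    qed
    then show "\<exists>N. \<forall>n\<ge>N. norm (W2 (density lborel (\<lambda>x. ennreal (f x))) (\<mu> (r n)) - 0) < e" by blast
  qed
  show ?thesis
    by (rule that[OF r lim f_meas off f0 mass _ W2])
       (auto intro!: density_bounded_support_in_P2[OF f_meas mass bounded_cbox off])
qed

lemma W2_continuous_tendsto:
  assumes "W2_continuous V" "x \<longlonglongrightarrow> x0" "\<mu> \<in> P2" "\<And>n. \<nu> n \<in> P2" "(\<lambda>n. W2 \<mu> (\<nu> n)) \<longlonglongrightarrow> 0"
  shows "(\<lambda>n. V (x n) (\<nu> n)) \<longlonglongrightarrow> V x0 \<mu>"
proof (rule tendstoI)
  fix e :: real assume "0 < e"
  with assms(1,3) obtain \<delta> where \<delta>: "\<delta> > 0"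
    "\<And>y \<nu>. \<nu> \<in> P2 \<Longrightarrow> dist x0 y < \<delta> \<Longrightarrow> W2 \<mu> \<nu> < \<delta> \<Longrightarrow> dist (V x0 \<mu>) (V y \<nu>) < e"
    unfolding W2_continuous_def by blast
  have "eventually (\<lambda>n. dist (x n) x0 < \<delta>) sequentially" "eventually (\<lambda>n. W2 \<mu> (\<nu> n) < \<delta>) sequentially"
    using assms(2,5) \<delta>(1) by (auto intro: tendstoD order_tendstoD)
  then show "eventually (\<lambda>n. dist (V (x n) (\<nu> n)) (V x0 \<mu>) < e) sequentially"
    by eventually_elim (metis \<delta>(2) assms(4) dist_commute)
qed

section \<open>Centers and masses of bins\<close>

text \<open>
  This is why the enumeration of the bins reaches every combination of positions along the
  coordinates. The new leading digit \<open>t d\<close> leaves the lower digits unchanged.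
\<close>
lemma exists_number_with_digits:
  fixes t :: "nat \<Rightarrow> nat"
  assumes "\<And>j. j < d \<Longrightarrow> t j < n"
  shows "\<exists>k < n ^ d. \<forall>j<d. (k div n ^ j) mod n = t j"
  using assms
proof (induction d)
  case 0
  show ?case by (intro exI[of _ 0]) simp
next
  case (Suc d)
  then obtain k where k: "k < n ^ d" "\<And>j. j < d \<Longrightarrow> (k div n ^ j) mod n = t j" by force
  have td: "t d < n" using Suc.prems by simp
  then have n: "n > 0" by simp
  let ?k = "k + t d * n ^ d"
  have "?k < n ^ d + t d * n ^ d" using k(1) by simp
  also have "\<dots> = (t d + 1) * n ^ d" by (simp add: algebra_simps)
  also have "\<dots> \<le> n * n ^ d" using td by (intro mult_right_mono) auto
  finally have less: "?k < n ^ Suc d" by simp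
  have "(?k div n ^ j) mod n = t j" if "j < Suc d" for j
  proof (cases "j = d")
    case True
    then show ?thesis using k(1) td n by simp
  next
    case False
    with that have j: "j < d" by simp
    then obtain i where i: "d = j + Suc i" by (metis less_iff_Suc_add add_Suc_right)
    have "?k div n ^ j = (k + (t d * n ^ Suc i) * n ^ j) div n ^ j"
      unfolding i by (simp add: power_add mult_ac)
    also have "\<dots> = t d * n ^ Suc i + k div n ^ j"
      by (rule div_mult_self1) (use n in simp)
    also have "\<dots> = k div n ^ j + (t d * n ^ i) * n"
      by simp
    finally show ?thesis using k(2)[OF j] by simp
  qed
  with less show ?case by blast
qed

lemma to_nat_on_less_CARD: "to_nat_on (UNIV :: 'd::finite set) i < CARD('d)"
  using bij_betwE[OF to_nat_on_finite[of "UNIV :: 'd set"]] by auto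

lemma bin_center_nth:
  "bin_center a b n k $ i = a $ i + (real (bin_digit n k i) + 1/2) * ((b $ i - a $ i) / real n)"
proof -
  have avg: "inverse 2 * ((p + t * w) + (p + (t + 1) * w)) = p + (t + 1/2) * w" for p t w :: real
    by (simp add: field_simps)
  show ?thesis
    unfolding bin_center_def midpoint_def bin_lower_def bin_upper_def vector_scaleR_component
      vector_add_component vec_lambda_beta real_scaleR_def
    by (rule avg)
qed

lemma bin_center_in_cbox:
  fixes a b :: "real^'d"
  assumes ab: "\<And>i. a $ i < b $ i" and n: "n \<ge> 1"
  shows "bin_center a b n k \<in> cbox a b"
  unfolding mem_box_cart
proof
  fix i
  let ?w = "(b $ i - a $ i) / real n"
  have "bin_digit n k i < n" using n by (simp add: bin_digit_def)
  then have "real (bin_digit n k i) + 1 \<le> real n" by linarith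
  then have "(real (bin_digit n k i) + 1/2) * ?w \<le> real n * ?w"
    using ab[of i] n by (intro mult_right_mono) auto
  moreover have "0 \<le> (real (bin_digit n k i) + 1/2) * ?w"
    using ab[of i] by (intro mult_nonneg_nonneg) auto
  ultimately show "a $ i \<le> bin_center a b n k $ i \<and> bin_center a b n k $ i \<le> b $ i"
    unfolding bin_center_nth using n by simp
qed

lemma bin_center_near:
  fixes a b :: "real^'d"
  assumes ab: "\<And>i. a $ i < b $ i" and n: "n \<ge> 1" and y: "y \<in> cbox a b"
  shows "\<exists>k < n ^ CARD('d). norm (bin_center a b n k - y) \<le> (\<Sum>i\<in>UNIV. b $ i - a $ i) / real n"
proof -
  define w where "w i = (b $ i - a $ i) / real n" for i
  have w: "w i > 0" "real n * w i = b $ i - a $ i" for i using ab[of i] n by (auto simp: w_def)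
  define q where "q i = (y $ i - a $ i) / w i" for i
  have q: "0 \<le> q i" "q i \<le> real n" "q i * w i = y $ i - a $ i" for i
    using y[unfolded mem_box_cart, rule_format, of i] w[of i]
    by (auto simp: q_def divide_le_eq)
  \<comment> \<open>the right end of the side belongs to the last interval, hence the minimum\<close>
  define u where "u i = min (n - 1) (nat \<lfloor>q i\<rfloor>)" for i
  have u: "u i < n" "\<bar>real (u i) + 1/2 - q i\<bar> \<le> 1" for i
  proof -
    show "u i < n" using n by (auto simp: u_def)
    define l where "l = nat \<lfloor>q i\<rfloor>"
    have l: "real l \<le> q i" "q i < real l + 1"
      unfolding l_def using q(1)[of i] by linarith+
    show "\<bar>real (u i) + 1/2 - q i\<bar> \<le> 1"
      using q(2)[of i] n l unfolding u_def l_def[symmetric] min_def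
      by (auto simp: of_nat_diff abs_le_iff)
  qed
  obtain k where k: "k < n ^ CARD('d)"
    "\<forall>j<CARD('d). (k div n ^ j) mod n = u (from_nat_into UNIV j)"
    using exists_number_with_digits[of "CARD('d)" "\<lambda>j. u (from_nat_into UNIV j)" n] u(1) by blast
  have digit: "bin_digit n k i = u i" for i
    using k(2) to_nat_on_less_CARD[of i] by (simp add: bin_digit_def)
  have "\<bar>(bin_center a b n k - y) $ i\<bar> \<le> w i" for i
  proof -
    have "(bin_center a b n k - y) $ i = (real (u i) + 1/2 - q i) * w i"
      unfolding vector_minus_component bin_center_nth digit left_diff_distrib q(3)
      by (simp add: w_def)
    then show ?thesis using u(2)[of i] w(1)[of i] by (simp add: abs_mult)
  qed
  then have "norm (bin_center a b n k - y) \<le> (\<Sum>i\<in>UNIV. w i)"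
    by (intro order_trans[OF norm_le_l1_cart] sum_mono)
  also have "\<dots> = (\<Sum>i\<in>UNIV. b $ i - a $ i) / real n"
    by (simp add: w_def sum_divide_distrib)
  finally show ?thesis using k(1) by blast
qed

lemma bin_volume_pos:
  fixes a b :: "real^'d"
  assumes "\<And>i. a $ i < b $ i" "n \<ge> 1"
  shows "bin_volume a b n > 0"
proof -
  have "measure lborel (cbox a b) = (\<Prod>i\<in>UNIV. b $ i - a $ i)"
    using assms by (intro content_cbox_cart) (auto simp: interval_ne_empty_cart intro: less_imp_le)
  also have "\<dots> > 0" using assms by (intro prod_pos) simp
  finally show ?thesis using assms by (simp add: bin_volume_def)
qed

lemma bin_mass_nonneg:
  fixes a b :: "real^'d"
  assumes "\<mu> \<in> D_c S"
  shows "bin_mass a b n \<mu> \<ge> 0"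
  unfolding bin_mass_def bin_volume_def
  by (intro sum_nonneg mult_nonneg_nonneg cont_density_nonneg[OF assms]) simp

lemma bin_mass_le:
  fixes a b :: "real^'d"
  assumes "\<And>x. cont_density \<mu> x \<le> M" "n \<ge> 1"
  shows "bin_mass a b n \<mu> \<le> M * measure lborel (cbox a b)"
proof -
  have "bin_mass a b n \<mu> \<le> (\<Sum>j < n ^ CARD('d). M * bin_volume a b n)"
    unfolding bin_mass_def
    by (intro sum_mono mult_right_mono assms(1)) (simp add: bin_volume_def)
  also have "\<dots> = M * measure lborel (cbox a b)"
    using assms(2) by (simp add: bin_volume_def)
  finally show ?thesis .
qed

text \<open>
  The normalization forces \<open>p\<^sub>k h \<le> 1\<close> for the bin volume \<open>h\<close>, so for fixed \<open>n\<close> the density bins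
  range over a bounded set.
\<close>
lemma density_bins_bounded:
  fixes a b :: "real^'d"
  assumes ab: "\<And>i. a $ i < b $ i" and n: "n \<ge> 1" and \<mu>: "\<mu> \<in> D_c S" and k: "k < n ^ CARD('d)"
  shows "0 \<le> cont_density \<mu> (bin_center a b n k) / bin_mass a b n \<mu>"
    and "cont_density \<mu> (bin_center a b n k) / bin_mass a b n \<mu> \<le> 1 / bin_volume a b n"
proof -
  have h: "bin_volume a b n > 0" by (rule bin_volume_pos[OF ab n])
  show "0 \<le> cont_density \<mu> (bin_center a b n k) / bin_mass a b n \<mu>"
    using bin_mass_nonneg[OF \<mu>] cont_density_nonneg[OF \<mu>] by simp
  have "cont_density \<mu> (bin_center a b n k) * bin_volume a b n \<le> bin_mass a b n \<mu>"
    unfolding bin_mass_def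
    by (rule member_le_sum) (use k h cont_density_nonneg[OF \<mu>] in auto)
  then show "cont_density \<mu> (bin_center a b n k) / bin_mass a b n \<mu> \<le> 1 / bin_volume a b n"
    using h bin_mass_nonneg[OF \<mu>, of a b n]
    by (cases "bin_mass a b n \<mu> = 0") (auto simp: field_simps)
qed

text \<open>
  A density of total mass one exceeds a fixed level somewhere in the box; by equicontinuity it is
  still positive at a center close to that place, and one positive summand is enough. The threshold
  \<open>N\<close> depends only on the common modulus.
\<close>
lemma eventually_bin_mass_pos:
  fixes a b :: "real^'d"
  assumes ab: "\<And>i. a $ i < b $ i"
    and mod: "modulus_of_continuity \<omega>" "open U" "0 \<in> U"
  obtains N where "N \<ge> 1"
    "\<And>n \<mu>. n \<ge> N \<Longrightarrow> \<mu> \<in> D_c_mod (cbox a b) \<omega> U \<Longrightarrow> bin_mass a b n \<mu> > 0"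
proof -
  let ?S = "cbox a b"
  define L where "L = measure lborel ?S"
  have L: "L > 0" using bin_volume_pos[OF ab, of 1] by (simp add: L_def bin_volume_def)
  define e where "e = 1 / (2 * L)"
  have e: "e > 0" "e * L = 1/2" using L by (auto simp: e_def)
  obtain d where d: "d > 0"
    "\<And>\<mu> x y. \<mu> \<in> D_c_mod ?S \<omega> U \<Longrightarrow> x \<in> ?S \<Longrightarrow> y \<in> ?S \<Longrightarrow> norm (x - y) < d \<Longrightarrow>
        \<bar>cont_density \<mu> x - cont_density \<mu> y\<bar> < e"
    using D_c_mod_equicontinuous[OF compact_cbox mod \<open>e > 0\<close>] by blast
  obtain N :: nat where N: "(\<Sum>i\<in>UNIV. b $ i - a $ i) / d < N" using reals_Archimedean2 by blast
  show ?thesis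
  proof
    show "N + 1 \<ge> 1" by simp
    fix n \<mu> assume n: "n \<ge> N + 1" and \<mu>: "\<mu> \<in> D_c_mod ?S \<omega> U"
    then have n1: "n \<ge> 1" by simp
    have \<mu>D: "\<mu> \<in> D_c ?S" using \<mu> by (auto simp: D_c_mod_def)
    let ?f = "cont_density \<mu>"
    \<comment> \<open>a density of total mass one cannot stay below \<open>1 / (2 L)\<close>\<close>
    have "\<exists>x\<in>?S. ?f x > e"
    proof (rule ccontr)
      assume "\<not> ?thesis"
      then have "ennreal (?f x) \<le> ennreal e * indicator ?S x" for x
        using cont_density_zero_outside[OF \<mu>D, of x]
        by (cases "x \<in> ?S") (auto simp: not_less intro!: ennreal_leI)
      then have "1 \<le> (\<integral>\<^sup>+ x. ennreal e * indicator ?S x \<partial>lborel)"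
        unfolding nn_integral_cont_density[OF \<mu>D, symmetric] by (intro nn_integral_mono)
      also have "emeasure lborel ?S = ennreal L"
        using emeasure_lborel_cbox_finite[of a b] unfolding L_def
        by (intro emeasure_eq_ennreal_measure) auto
      then have "(\<integral>\<^sup>+ x. ennreal e * indicator ?S x \<partial>lborel) = ennreal e * ennreal L"
        by (simp add: nn_integral_cmult_indicator)
      also have "ennreal e * ennreal L = ennreal (e * L)"
        using e L by (simp add: ennreal_mult)
      also have "\<dots> = ennreal (1/2)" by (simp only: e)
      finally have "ennreal 1 \<le> ennreal (1/2)" by simp
      then show False by (subst (asm) ennreal_le_iff) simp_all
    qed
    then obtain x where x: "x \<in> ?S" "?f x > e" by blast
    obtain k where k: "k < n ^ CARD('d)"
      "norm (bin_center a b n k - x) \<le> (\<Sum>i\<in>UNIV. b $ i - a $ i) / real n"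
      using bin_center_near[OF ab n1 x(1)] by blast
    note k(2)
    also have "(\<Sum>i\<in>UNIV. b $ i - a $ i) / real n < d"
    proof -
      have "(\<Sum>i\<in>UNIV. b $ i - a $ i) < real N * d" using N d by (simp add: field_simps)
      also have "\<dots> \<le> real n * d" using n d by (intro mult_right_mono) auto
      finally show ?thesis using n1 by (simp add: field_simps)
    qed
    finally have "\<bar>?f (bin_center a b n k) - ?f x\<bar> < e"
      by (intro d(2)[OF \<mu> bin_center_in_cbox[OF ab n1] x(1)])
    then have "?f (bin_center a b n k) > 0" using x by linarith
    then show "bin_mass a b n \<mu> > 0"
      unfolding bin_mass_def using k(1) bin_volume_pos[OF ab n1] cont_density_nonneg[OF \<mu>D]
      by (intro sum_pos2[where i=k]) auto
  qed
qed

section \<open>Separation by finitely many bins\<close>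

text \<open>
  The vector fed to the network, extended by zero. The type \<open>nat \<Rightarrow> real\<close> serves all \<open>n\<close> at once and,
  unlike the vectors of the matrix library, carries a topology.
\<close>
definition network_input :: "real^'d \<Rightarrow> real^'d \<Rightarrow> nat \<Rightarrow> real^'d \<Rightarrow> (real^'d) measure \<Rightarrow> nat \<Rightarrow> real" where
  "network_input a b n x \<mu> i =
     (if i < CARD('d) + n ^ CARD('d) then vec_index (to_vec x @\<^sub>v density_bins a b n \<mu>) i else 0)"

lemma network_input_point:
  fixes x :: "real^'d"
  shows "network_input a b n x \<mu> (to_nat_on (UNIV :: 'd set) i) = x $ i"
  using to_nat_on_less_CARD[of i] by (simp add: network_input_def to_vec_def density_bins_def)

lemma network_input_density:
  fixes x :: "real^'d"
  assumes "k < n ^ CARD('d)"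
  shows "network_input a b n x \<mu> (CARD('d) + k) = cont_density \<mu> (bin_center a b n k) / bin_mass a b n \<mu>"
  using assms by (simp add: network_input_def to_vec_def density_bins_def)

lemma component_le_sum_abs:
  fixes u w :: "nat \<Rightarrow> real"
  assumes "j < m"
  shows "\<bar>u j - w j\<bar> \<le> (\<Sum>i<m. \<bar>u i - w i\<bar>)"
  using assms by (intro member_le_sum[of j "{..<m}" "\<lambda>i. \<bar>u i - w i\<bar>"]) auto

text \<open>
  Otherwise the norm of \<open>V\<close> would tend to infinity along some sequence, while compactness provides a
  subsequence along which the values of \<open>V\<close> converge.
\<close>
lemma values_bounded:
  fixes a b :: "real^'d" and V :: "real^'d \<Rightarrow> (real^'d) measure \<Rightarrow> real^'p"
  assumes ab: "\<And>i. a $ i < b $ i"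
    and mod: "modulus_of_continuity \<omega>" "open U" "0 \<in> U" and V: "W2_continuous V"
  obtains M where "\<And>x \<mu>. x \<in> cbox a b \<Longrightarrow> \<mu> \<in> D_c_mod (cbox a b) \<omega> U \<Longrightarrow> norm (V x \<mu>) \<le> M"
proof (rule ccontr)
  assume "\<not> thesis"
  then have "\<forall>n::nat. \<exists>x \<mu>. x \<in> cbox a b \<and> \<mu> \<in> D_c_mod (cbox a b) \<omega> U \<and> norm (V x \<mu>) > real n"
    using that by (meson not_le)
  then obtain x \<mu> where x: "\<And>n. x n \<in> cbox a b"
    and \<mu>: "\<And>n::nat. \<mu> n \<in> D_c_mod (cbox a b) \<omega> U" and big: "\<And>n. norm (V (x n) (\<mu> n)) > real n"
    by metis
  obtain x0 q where "strict_mono (q :: nat \<Rightarrow> nat)" and q: "(x \<circ> q) \<longlonglongrightarrow> x0"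
    using x compact_cbox[of a b] unfolding compact_def by metis
  obtain r f where r: "strict_mono (r :: nat \<Rightarrow> nat)"
    and P2: "density lborel (\<lambda>x. ennreal (f x)) \<in> P2"
    and W: "(\<lambda>n. W2 (density lborel (\<lambda>x. ennreal (f x))) (\<mu> (q (r n)))) \<longlonglongrightarrow> 0"
    using D_c_mod_sequentially_compact[OF ab mod, of "\<lambda>n. \<mu> (q n)"] \<mu> by metis
  have "(\<lambda>n. V (x (q (r n))) (\<mu> (q (r n)))) \<longlonglongrightarrow> V x0 (density lborel (\<lambda>x. ennreal (f x)))"
    using LIMSEQ_subseq_LIMSEQ[OF q r] \<mu>
    by (intro W2_continuous_tendsto[OF V _ P2 _ W]) (auto simp: comp_def D_c_mod_def D_c_def)
  then have "Bseq (\<lambda>n. V (x (q (r n))) (\<mu> (q (r n))))"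
    by (intro convergent_imp_Bseq convergentI)
  then obtain B where B: "\<And>n. norm (V (x (q (r n))) (\<mu> (q (r n)))) \<le> B"
    by (auto simp: Bseq_def)
  obtain n :: nat where "B < n" using reals_Archimedean2 by blast
  also have "real n \<le> real (q (r n))"
    using seq_suble[OF strict_mono_o[OF \<open>strict_mono q\<close> r], of n] by simp
  finally show False using big[of "q (r n)"] B[of n] by linarith
qed

text \<open>
  Density bins compare \<open>F / \<alpha>\<close> with \<open>G / \<beta>\<close> for the masses \<open>\<alpha>\<close> and \<open>\<beta>\<close>. Multiplication by
  \<open>\<alpha> \<beta> / (\<alpha> + \<beta>)\<close> turns this into a comparison with weights in \<open>[0, 1]\<close> of sum 1, which have
  convergent subsequences; the new error is controlled by an upper bound of \<open>\<alpha>\<close>, and the proof does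
  without a lower bound of the masses.
\<close>
lemma weighted_difference_bound:
  fixes \<alpha> \<beta> F G t :: real
  assumes "\<alpha> > 0" "\<beta> > 0" "\<bar>F / \<alpha> - G / \<beta>\<bar> \<le> t"
  shows "\<bar>\<beta> / (\<alpha> + \<beta>) * F - (1 - \<beta> / (\<alpha> + \<beta>)) * G\<bar> \<le> \<alpha> * t"
proof -
  have "\<beta> / (\<alpha> + \<beta>) * F - (1 - \<beta> / (\<alpha> + \<beta>)) * G = (\<alpha> * (\<beta> / (\<alpha> + \<beta>))) * (F / \<alpha> - G / \<beta>)"
  proof -
    have "1 - \<beta> / (\<alpha> + \<beta>) = \<alpha> / (\<alpha> + \<beta>)" "\<alpha> * \<beta> * (F / \<alpha> - G / \<beta>) = \<beta> * F - \<alpha> * G"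
      using assms by (simp_all add: field_simps)
    then show ?thesis by (simp add: diff_divide_distrib flip: mult.assoc)
  qed
  then have "\<bar>\<beta> / (\<alpha> + \<beta>) * F - (1 - \<beta> / (\<alpha> + \<beta>)) * G\<bar> = (\<alpha> * (\<beta> / (\<alpha> + \<beta>))) * \<bar>F / \<alpha> - G / \<beta>\<bar>"
    using assms by (simp add: abs_mult)
  also have "\<dots> \<le> (\<alpha> * 1) * t"
    using assms by (intro mult_mono) auto
  finally show ?thesis by simp
qed

text \<open>
  The argument by contradiction outlined at the beginning. The weight \<open>s j\<close> in the proof is the one of
  \<open>weighted_difference_bound\<close>; its limit \<open>s0\<close> satisfies \<open>s0 * f = (1 - s0) * g\<close>, and integration
  yields \<open>s0 = 1/2\<close>, hence \<open>f = g\<close>.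
\<close>
theorem network_inputs_separate:
  fixes a b :: "real^'d" and V :: "real^'d \<Rightarrow> (real^'d) measure \<Rightarrow> real^'p"
  assumes ab: "\<And>i. a $ i < b $ i"
    and mod: "modulus_of_continuity \<omega>" "open U" "0 \<in> U" and V: "W2_continuous V"
    and \<epsilon>: "\<epsilon> > 0"
  obtains n \<eta> where "n \<ge> N" "\<eta> > 0"
    "\<And>x y \<mu> \<nu>. x \<in> cbox a b \<Longrightarrow> y \<in> cbox a b \<Longrightarrow>
       \<mu> \<in> D_c_mod (cbox a b) \<omega> U \<Longrightarrow> \<nu> \<in> D_c_mod (cbox a b) \<omega> U \<Longrightarrow>
       (\<Sum>i < CARD('d) + n ^ CARD('d). \<bar>network_input a b n x \<mu> i - network_input a b n y \<nu> i\<bar>) < \<eta> \<Longrightarrow>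
       norm (V x \<mu> - V y \<nu>) \<le> \<epsilon>"
proof (rule ccontr)
  assume no: "\<not> thesis"
  let ?S = "cbox a b" and ?D = "D_c_mod (cbox a b) \<omega> U"
  let ?d = "\<lambda>n x \<mu> y \<nu>. \<Sum>i < CARD('d) + n ^ CARD('d). \<bar>network_input a b n x \<mu> i - network_input a b n y \<nu> i\<bar>"
  obtain N' where N': "N' \<ge> 1" "\<And>n \<mu>. n \<ge> N' \<Longrightarrow> \<mu> \<in> ?D \<Longrightarrow> bin_mass a b n \<mu> > 0"
    using eventually_bin_mass_pos[OF ab mod] by blast
  obtain M where M: "0 < M" "\<And>\<mu> x. \<mu> \<in> ?D \<Longrightarrow> cont_density \<mu> x \<le> M"
    using D_c_mod_uniformly_bounded[OF ab mod] by blast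
  define h where "h j = max N N' + j" for j
  have h: "h j \<ge> N" "h j \<ge> N'" "h j \<ge> 1" "h j \<ge> j" for j using N'(1) by (auto simp: h_def)
  define bad where "bad j x \<mu> y \<nu> \<longleftrightarrow> x \<in> ?S \<and> y \<in> ?S \<and> \<mu> \<in> ?D \<and> \<nu> \<in> ?D \<and>
      ?d (h j) x \<mu> y \<nu> < 1 / real (h j) \<and> norm (V x \<mu> - V y \<nu>) > \<epsilon>" for j x \<mu> y \<nu>
  \<comment> \<open>the negated claim, for \<open>h j\<close> bins per side and the threshold \<open>1 / h j\<close>\<close>
  have "\<exists>x \<mu> y \<nu>. bad j x \<mu> y \<nu>" for j
  proof (rule ccontr)
    assume *: "\<not> ?thesis"
    have "norm (V x \<mu> - V y \<nu>) \<le> \<epsilon>"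
      if "x \<in> ?S" "y \<in> ?S" "\<mu> \<in> ?D" "\<nu> \<in> ?D" "?d (h j) x \<mu> y \<nu> < 1 / real (h j)" for x y \<mu> \<nu>
    proof (rule ccontr)
      assume "\<not> ?thesis"
      with that have "bad j x \<mu> y \<nu>" unfolding bad_def by simp
      with * show False by blast
    qed
    then have thesis
      by (rule that[of "h j" "1 / real (h j)", rotated 2]) (use h[of j] in simp_all)
    with no show False ..
  qed
  then obtain x \<mu> y \<nu> where "\<And>j. bad j (x j) (\<mu> j) (y j) (\<nu> j)"
    by metis
  then have x: "x j \<in> ?S" and y: "y j \<in> ?S" and \<mu>: "\<mu> j \<in> ?D" and \<nu>: "\<nu> j \<in> ?D"
    and close: "?d (h j) (x j) (\<mu> j) (y j) (\<nu> j) < 1 / real (h j)"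
    and far: "norm (V (x j) (\<mu> j) - V (y j) (\<nu> j)) > \<epsilon>" for j
    unfolding bad_def by blast+
  have \<mu>D: "\<mu> j \<in> D_c ?S" and \<nu>D: "\<nu> j \<in> D_c ?S" for j using \<mu> \<nu> by (auto simp: D_c_mod_def)
  define s where "s j = bin_mass a b (h j) (\<nu> j) / (bin_mass a b (h j) (\<mu> j) + bin_mass a b (h j) (\<nu> j))" for j
  have mass: "bin_mass a b (h j) (\<mu> j) > 0" "bin_mass a b (h j) (\<nu> j) > 0" for j
    using N'(2)[OF h(2)] \<mu> \<nu> by auto
  have s: "s j \<in> {0..1}" for j using mass[of j] by (auto simp: s_def)
  \<comment> \<open>one common subsequence \<open>r\<close> for the weights, the points and both sequences of densities\<close>
  obtain s0 q0 where q0: "strict_mono (q0 :: nat \<Rightarrow> nat)" and s0: "(s \<circ> q0) \<longlonglongrightarrow> s0"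
    using s compact_Icc[of 0 "1::real"] unfolding compact_def by metis
  obtain x0 q1 where q1: "strict_mono (q1 :: nat \<Rightarrow> nat)" and x0: "((x \<circ> q0) \<circ> q1) \<longlonglongrightarrow> x0"
    using x compact_cbox[of a b] unfolding compact_def by (metis comp_apply)
  obtain q2 f where q2: "strict_mono (q2 :: nat \<Rightarrow> nat)"
    and f_lim: "\<And>z. (\<lambda>j. cont_density (\<mu> (q0 (q1 (q2 j)))) z) \<longlonglongrightarrow> f z"
    and f: "f \<in> borel_measurable borel" "\<And>z. z \<notin> ?S \<Longrightarrow> f z = 0" "\<And>z. 0 \<le> f z"
      "(\<integral>\<^sup>+ z. ennreal (f z) \<partial>lborel) = 1" "density lborel (\<lambda>z. ennreal (f z)) \<in> P2"
    and f_W: "(\<lambda>j. W2 (density lborel (\<lambda>z. ennreal (f z))) (\<mu> (q0 (q1 (q2 j))))) \<longlonglongrightarrow> 0"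
    by (rule D_c_mod_sequentially_compact[OF ab mod, of "\<lambda>j. \<mu> (q0 (q1 j))"]) (use \<mu> in blast)+
  obtain q3 g where q3: "strict_mono (q3 :: nat \<Rightarrow> nat)"
    and g_lim: "\<And>z. (\<lambda>j. cont_density (\<nu> (q0 (q1 (q2 (q3 j))))) z) \<longlonglongrightarrow> g z"
    and g: "g \<in> borel_measurable borel" "\<And>z. z \<notin> ?S \<Longrightarrow> g z = 0" "\<And>z. 0 \<le> g z"
      "(\<integral>\<^sup>+ z. ennreal (g z) \<partial>lborel) = 1" "density lborel (\<lambda>z. ennreal (g z)) \<in> P2"
    and g_W: "(\<lambda>j. W2 (density lborel (\<lambda>z. ennreal (g z))) (\<nu> (q0 (q1 (q2 (q3 j)))))) \<longlonglongrightarrow> 0"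
    by (rule D_c_mod_sequentially_compact[OF ab mod, of "\<lambda>j. \<nu> (q0 (q1 (q2 j)))"]) (use \<nu> in blast)+
  define r where "r j = q0 (q1 (q2 (q3 j)))" for j
  have r: "strict_mono r"
    using strict_mono_o[OF q0 strict_mono_o[OF q1 strict_mono_o[OF q2 q3]]]
    by (simp add: r_def[abs_def] comp_def)
  have f_lim: "(\<lambda>j. cont_density (\<mu> (r j)) z) \<longlonglongrightarrow> f z" for z
    using LIMSEQ_subseq_LIMSEQ[OF f_lim q3] by (simp add: comp_def r_def)
  have g_lim: "(\<lambda>j. cont_density (\<nu> (r j)) z) \<longlonglongrightarrow> g z" for z
    using g_lim by (simp add: r_def)
  have f_W: "(\<lambda>j. W2 (density lborel (\<lambda>z. ennreal (f z))) (\<mu> (r j))) \<longlonglongrightarrow> 0"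
    using LIMSEQ_subseq_LIMSEQ[OF f_W q3] by (simp add: comp_def r_def)
  have g_W: "(\<lambda>j. W2 (density lborel (\<lambda>z. ennreal (g z))) (\<nu> (r j))) \<longlonglongrightarrow> 0"
    using g_W by (simp add: r_def)
  have s_lim: "(\<lambda>j. s (r j)) \<longlonglongrightarrow> s0"
    using LIMSEQ_subseq_LIMSEQ[OF s0 strict_mono_o[OF strict_mono_o[OF q1 q2] q3]]
    by (simp add: comp_def r_def)
  have x_lim: "(\<lambda>j. x (r j)) \<longlonglongrightarrow> x0"
    using LIMSEQ_subseq_LIMSEQ[OF x0 strict_mono_o[OF q2 q3]] by (simp add: comp_def r_def)
  have inv: "(\<lambda>j. 1 / real (h (r j))) \<longlonglongrightarrow> 0"
  proof (rule tendsto_sandwich[OF _ _ tendsto_const lim_1_over_n])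
    show "eventually (\<lambda>j. 1 / real (h (r j)) \<le> 1 / real j) sequentially"
      using eventually_gt_at_top[of 0]
    proof eventually_elim
      case (elim j)
      have "j \<le> h (r j)" using seq_suble[OF r, of j] h(4)[of "r j"] by linarith
      then show ?case using elim by (intro divide_left_mono) auto
    qed
  qed auto
  \<comment> \<open>the first coordinates of the network inputs are those of the points\<close>
  have y_lim: "(\<lambda>j. y (r j)) \<longlonglongrightarrow> x0"
  proof -
    have "norm (y (r j) - x (r j)) \<le> real CARD('d) * (1 / real (h (r j)))" for j
    proof -
      have "\<bar>(y (r j) - x (r j)) $ i\<bar> \<le> 1 / real (h (r j))" for i
        using component_le_sum_abs[of "to_nat_on (UNIV::'d set) i" "CARD('d) + h (r j) ^ CARD('d)"
            "network_input a b (h (r j)) (x (r j)) (\<mu> (r j))"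
            "network_input a b (h (r j)) (y (r j)) (\<nu> (r j))"]
          to_nat_on_less_CARD[of i] close[of "r j"]
        by (simp add: network_input_point abs_minus_commute)
      then have "(\<Sum>i\<in>UNIV. \<bar>(y (r j) - x (r j)) $ i\<bar>) \<le> (\<Sum>i\<in>(UNIV::'d set). 1 / real (h (r j)))"
        by (intro sum_mono)
      then show ?thesis using norm_le_l1_cart[of "y (r j) - x (r j)"] by simp
    qed
    then have "eventually (\<lambda>j. norm (y (r j) - x (r j)) \<le> real CARD('d) * (1 / real (h (r j)))) sequentially"
      by (intro always_eventually allI)
    from Lim_null_comparison[OF this tendsto_mult_right_zero[OF inv]]
    have "(\<lambda>j. y (r j) - x (r j)) \<longlonglongrightarrow> 0" .
    from tendsto_add[OF this x_lim] show ?thesis by simp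
  qed
  \<comment> \<open>compare the densities at centers \<open>c j\<close> that converge to \<open>z\<close>\<close>
  have proportional: "s0 * f z = (1 - s0) * g z" if z: "z \<in> ?S" for z
  proof -
    have "\<exists>k < h j ^ CARD('d). norm (bin_center a b (h j) k - z) \<le> (\<Sum>i\<in>UNIV. b $ i - a $ i) / real (h j)" for j
      by (rule bin_center_near[OF ab h(3) z])
    then obtain k where k: "\<And>j. k j < h j ^ CARD('d)"
      "\<And>j. norm (bin_center a b (h j) (k j) - z) \<le> (\<Sum>i\<in>UNIV. b $ i - a $ i) / real (h j)"
      by metis
    define c where "c j = bin_center a b (h j) (k j)" for j
    have c_in: "c j \<in> ?S" for j unfolding c_def by (rule bin_center_in_cbox[OF ab h(3)])
    have "eventually (\<lambda>j. norm (c (r j) - z) \<le> (\<Sum>i\<in>UNIV. b $ i - a $ i) * (1 / real (h (r j)))) sequentially"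
      using k(2) by (intro always_eventually allI) (simp add: c_def)
    from Lim_null_comparison[OF this tendsto_mult_right_zero[OF inv]]
    have c_lim: "(\<lambda>j. c (r j)) \<longlonglongrightarrow> z" by (simp add: LIM_zero_iff)
    have F: "(\<lambda>j. cont_density (\<mu> (r j)) (c (r j))) \<longlonglongrightarrow> f z"
      by (rule D_c_mod_tendsto_along[where \<rho> = "\<lambda>j. \<mu> (r j)" and c = "\<lambda>j. c (r j)",
            OF compact_cbox mod \<mu> c_in z c_lim f_lim])
    have G: "(\<lambda>j. cont_density (\<nu> (r j)) (c (r j))) \<longlonglongrightarrow> g z"
      by (rule D_c_mod_tendsto_along[where \<rho> = "\<lambda>j. \<nu> (r j)" and c = "\<lambda>j. c (r j)",
            OF compact_cbox mod \<nu> c_in z c_lim g_lim])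
    let ?L = "M * measure lborel ?S"
    let ?diff = "\<lambda>j. s j * cont_density (\<mu> j) (c j) - (1 - s j) * cont_density (\<nu> j) (c j)"
    have bound: "norm (?diff j) \<le> ?L * (1 / real (h j))" for j
    proof -
      have "\<bar>cont_density (\<mu> j) (c j) / bin_mass a b (h j) (\<mu> j)
            - cont_density (\<nu> j) (c j) / bin_mass a b (h j) (\<nu> j)\<bar> \<le> 1 / real (h j)"
        using component_le_sum_abs[of "CARD('d) + k j" "CARD('d) + h j ^ CARD('d)"
            "network_input a b (h j) (x j) (\<mu> j)" "network_input a b (h j) (y j) (\<nu> j)"]
          k(1)[of j] close[of j]
        by (simp add: network_input_density c_def)
      from weighted_difference_bound[OF mass(1) mass(2) this]
      have "norm (?diff j) \<le> bin_mass a b (h j) (\<mu> j) * (1 / real (h j))"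
        unfolding s_def by simp
      also have "\<dots> \<le> ?L * (1 / real (h j))"
        by (intro mult_right_mono bin_mass_le[OF M(2)[OF \<mu>] h(3)]) simp
      finally show ?thesis .
    qed
    have 1: "(\<lambda>j. ?diff (r j)) \<longlonglongrightarrow> s0 * f z - (1 - s0) * g z"
      by (intro tendsto_intros s_lim F G)
    have "eventually (\<lambda>j. norm (?diff (r j)) \<le> ?L * (1 / real (h (r j)))) sequentially"
      using bound by (intro always_eventually allI)
    from Lim_null_comparison[OF this tendsto_mult_right_zero[OF inv]]
    have 2: "(\<lambda>j. ?diff (r j)) \<longlonglongrightarrow> 0" .
    show ?thesis using LIMSEQ_unique[OF 1 2] by simp
  qed
  have s01: "0 \<le> s0" "s0 \<le> 1"
    using LIMSEQ_le_const[OF s_lim, of 0] LIMSEQ_le_const2[OF s_lim, of 1] s by auto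
  have eq: "s0 * f z = (1 - s0) * g z" for z
    using proportional[of z] f(2)[of z] g(2)[of z] by (cases "z \<in> ?S") auto
  have "ennreal s0 = (\<integral>\<^sup>+ z. ennreal s0 * ennreal (f z) \<partial>lborel)"
    using f by (subst nn_integral_cmult) auto
  also have "\<dots> = (\<integral>\<^sup>+ z. ennreal (1 - s0) * ennreal (g z) \<partial>lborel)"
    using eq s01 f(3) g(3) by (simp add: ennreal_mult[symmetric])
  also have "\<dots> = ennreal (1 - s0)"
    using g by (subst nn_integral_cmult) auto
  finally have half: "s0 = 1 / 2" using s01 by simp
  have fg: "f = g" using eq unfolding half by (intro ext) simp
  let ?\<rho> = "density lborel (\<lambda>z. ennreal (f z))"
  have "(\<lambda>j. V (x (r j)) (\<mu> (r j)) - V (y (r j)) (\<nu> (r j))) \<longlonglongrightarrow> V x0 ?\<rho> - V x0 ?\<rho>"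
    using \<mu>D \<nu>D g_W[folded fg]
    by (intro tendsto_diff W2_continuous_tendsto[OF V _ f(5)] x_lim y_lim f_W) (auto simp: D_c_def)
  then have "(\<lambda>j. norm (V (x (r j)) (\<mu> (r j)) - V (y (r j)) (\<nu> (r j)))) \<longlonglongrightarrow> 0"
    by (simp add: tendsto_norm_zero)
  then have "eventually (\<lambda>j. norm (V (x (r j)) (\<mu> (r j)) - V (y (r j)) (\<nu> (r j))) < \<epsilon>) sequentially"
    using \<epsilon> by (rule order_tendstoD)
  then obtain j where "norm (V (x (r j)) (\<mu> (r j)) - V (y (r j)) (\<nu> (r j))) < \<epsilon>"
    by (auto simp: eventually_sequentially)
  with far[of "r j"] show False by simp
qed

section \<open>Lipschitz interpolation of functions of the network input\<close>

text \<open>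
  McShane's formula \<open>G z = sup {v p - L * d z (e p)}\<close>, where \<open>d\<close> is the \<open>\<ell>\<^sup>1\<close> distance of the first \<open>m\<close>
  coordinates. At \<open>z = e p\<close> the site \<open>p\<close> itself contributes \<open>v p\<close>; sites closer than \<open>\<eta>\<close> contribute
  at most \<open>v p + \<epsilon>\<close>, and the slope \<open>L\<close> is so large that more distant sites do not matter.
\<close>
lemma Lipschitz_interpolation:
  fixes e :: "'z \<Rightarrow> nat \<Rightarrow> real" and v :: "'z \<Rightarrow> real"
  assumes bounded: "\<And>p. p \<in> Z \<Longrightarrow> \<bar>v p\<bar> \<le> M"
    and \<eta>: "\<eta> > 0"
    and close: "\<And>p q. p \<in> Z \<Longrightarrow> q \<in> Z \<Longrightarrow> (\<Sum>i<m. \<bar>e p i - e q i\<bar>) < \<eta> \<Longrightarrow> \<bar>v p - v q\<bar> \<le> \<epsilon>"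
  obtains G where "continuous_on UNIV G" "\<And>p. p \<in> Z \<Longrightarrow> \<bar>G (e p) - v p\<bar> \<le> \<epsilon>"
proof (cases "Z = {}")
  case True
  then show ?thesis using that[of "\<lambda>_. 0"] by simp
next
  case False
  then have M: "0 \<le> M" using bounded by force
  define d where "d x y = (\<Sum>i<m. \<bar>x i - y i\<bar>)" for x y :: "nat \<Rightarrow> real"
  have d: "0 \<le> d x y" "d x x = 0" "d x y \<le> d x z + d z y" "d x y = d y x" for x y z
  proof -
    show "d x y \<le> d x z + d z y"
      unfolding d_def sum.distrib[symmetric] by (intro sum_mono) linarith
  qed (auto simp: d_def sum_nonneg abs_minus_commute)
  \<comment> \<open>with this slope, sites at distance at least the threshold contribute at most \<open>- M\<close>\<close>
  define L where "L = 2 * M / \<eta>"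
  have L: "0 \<le> L" "L * \<eta> = 2 * M" using M \<eta> by (auto simp: L_def)
  define G where "G z = (SUP p\<in>Z. v p - L * d z (e p))" for z
  have bdd: "bdd_above ((\<lambda>p. v p - L * d z (e p)) ` Z)" for z
  proof (rule bdd_aboveI2[where M=M])
    fix p assume "p \<in> Z"
    moreover have "0 \<le> L * d z (e p)" using L d by simp
    ultimately show "v p - L * d z (e p) \<le> M" using bounded[of p] by linarith
  qed
  have lip: "G z \<le> G z' + L * d z z'" for z z'
    unfolding G_def
  proof (rule cSUP_least[OF False])
    fix p assume p: "p \<in> Z"
    have "L * d z' (e p) \<le> L * (d z z' + d z (e p))"
      using d(3)[of z' "e p" z] d(4)[of z' z] L by (intro mult_left_mono) auto
    then have "v p - L * d z (e p) \<le> (v p - L * d z' (e p)) + L * d z z'"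
      by (simp add: distrib_left)
    also have "\<dots> \<le> (SUP p\<in>Z. v p - L * d z' (e p)) + L * d z z'"
      by (intro add_right_mono cSUP_upper p bdd)
    finally show "v p - L * d z (e p) \<le> (SUP p\<in>Z. v p - L * d z' (e p)) + L * d z z'" .
  qed
  show ?thesis
  proof
    show "continuous_on UNIV G"
      unfolding continuous_on_def
    proof
      fix z
      have "continuous_on UNIV (\<lambda>z'. L * d z' z)"
        unfolding d_def
        by (intro continuous_intros continuous_on_product_coordinates)
      then have "((\<lambda>z'. L * d z' z) \<longlongrightarrow> L * d z z) (at z within UNIV)"
        unfolding continuous_on_def by blast
      then have 0: "((\<lambda>z'. L * d z' z) \<longlongrightarrow> 0) (at z within UNIV)" by (simp add: d)
      have "((\<lambda>z'. G z' - G z) \<longlongrightarrow> 0) (at z within UNIV)"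
      proof (rule Lim_null_comparison[OF _ 0], rule always_eventually, rule allI)
        fix z'
        show "norm (G z' - G z) \<le> L * d z' z"
          using lip[of z z'] lip[of z' z] d(4)[of z z'] by auto
      qed
      then show "(G \<longlongrightarrow> G z) (at z within UNIV)" by (simp add: LIM_zero_iff)
    qed
    fix p assume p: "p \<in> Z"
    have "v p - L * d (e p) (e p) \<le> G (e p)"
      unfolding G_def by (intro cSUP_upper p bdd)
    then have lower: "v p \<le> G (e p)" by (simp add: d)
    have "G (e p) \<le> v p + \<epsilon>"
      unfolding G_def
    proof (rule cSUP_least[OF False])
      fix q assume q: "q \<in> Z"
      have Ld: "0 \<le> L * d (e p) (e q)" using L d by simp
      show "v q - L * d (e p) (e q) \<le> v p + \<epsilon>"
      proof (cases "d (e p) (e q) < \<eta>")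
        case True
        then have "\<bar>v p - v q\<bar> \<le> \<epsilon>" using close[OF p q] by (simp add: d_def)
        then show ?thesis using Ld by linarith
      next
        case False
        then have "L * \<eta> \<le> L * d (e p) (e q)" using L by (intro mult_left_mono) auto
        moreover have "0 \<le> \<epsilon>" using close[OF p p] \<eta> by simp
        ultimately show ?thesis using bounded[OF p] bounded[OF q] L by linarith
      qed
    qed
    with lower show "\<bar>G (e p) - v p\<bar> \<le> \<epsilon>" by simp
  qed
qed

section \<open>Approximation of the exponential by one-dimensional units\<close>

inductive_set affine_span :: "('a \<Rightarrow> real) set \<Rightarrow> ('a \<Rightarrow> real) set" for B where
  const: "(\<lambda>_. c) \<in> affine_span B"
| base: "f \<in> B \<Longrightarrow> f \<in> affine_span B"
| add: "f \<in> affine_span B \<Longrightarrow> g \<in> affine_span B \<Longrightarrow> (\<lambda>x. f x + g x) \<in> affine_span B"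
| scale: "f \<in> affine_span B \<Longrightarrow> (\<lambda>x. c * f x) \<in> affine_span B"

lemma affine_span_sum:
  assumes "\<And>i. i \<in> I \<Longrightarrow> f i \<in> affine_span B"
  shows "(\<lambda>x. \<Sum>i\<in>I. f i x) \<in> affine_span B"
  using assms
  by (induction I rule: infinite_finite_induct) (auto intro: affine_span.intros)

lemma affine_span_comp:
  assumes "h \<in> affine_span B" and "\<And>g. g \<in> B \<Longrightarrow> (\<lambda>x. g (T x)) \<in> affine_span C"
  shows "(\<lambda>x. h (T x)) \<in> affine_span C"
  using assms(1) by induction (auto intro: affine_span.intros assms(2))

definition ridge_units :: "(real \<Rightarrow> real) \<Rightarrow> (real \<Rightarrow> real) set" where
  "ridge_units \<sigma> = {\<lambda>t. \<sigma> (u * t + v) | u v. True}"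

definition neurons :: "(real \<Rightarrow> real) \<Rightarrow> nat \<Rightarrow> ((nat \<Rightarrow> real) \<Rightarrow> real) set" where
  "neurons \<sigma> m = {\<lambda>z. \<sigma> ((\<Sum>i<m. w i * z i) + c) | w c. True}"

lemma ridge_units_rescale:
  assumes "s \<in> affine_span (ridge_units \<sigma>)"
  shows "(\<lambda>t. s (u * t + v)) \<in> affine_span (ridge_units \<sigma>)"
proof (rule affine_span_comp[OF assms])
  fix g assume "g \<in> ridge_units \<sigma>"
  then obtain u' v' where g: "g = (\<lambda>t. \<sigma> (u' * t + v'))"
    by (auto simp: ridge_units_def)
  have "(\<lambda>t. g (u * t + v)) = (\<lambda>t. \<sigma> ((u' * u) * t + (u' * v + v')))"
    unfolding g by (simp add: algebra_simps)
  then show "(\<lambda>t. g (u * t + v)) \<in> affine_span (ridge_units \<sigma>)"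
    by (intro affine_span.base) (auto simp: ridge_units_def)
qed

text \<open>
  The three activation functions are treated alike from here on, because each of them produces a
  monotone transition from 0 to 1: the sigmoid itself, \<open>(1 + tanh t) / 2\<close>, and
  \<open>relu t - relu (t - 1)\<close>.
\<close>
lemma sigmoidal_in_affine_span:
  assumes "\<sigma> \<in> {tanh, sigmoid, relu}"
  obtains s where "s \<in> affine_span (ridge_units \<sigma>)" "mono s" "\<And>t. 0 \<le> s t" "\<And>t. s t \<le> 1"
    "(s \<longlongrightarrow> 0) at_bot" "(s \<longlongrightarrow> 1) at_top"
proof -
  have unit: "(\<lambda>t. \<sigma> (u * t + v)) \<in> affine_span (ridge_units \<sigma>)" for u v
    by (rule affine_span.base) (auto simp: ridge_units_def)
  consider "\<sigma> = tanh" | "\<sigma> = sigmoid" | "\<sigma> = relu" using assms by blast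
  then show ?thesis
  proof cases
    case 1
    show ?thesis
    proof (rule that)
      show "(\<lambda>t. 1/2 + 1/2 * tanh t) \<in> affine_span (ridge_units \<sigma>)"
        using unit[of 1 0] 1 by (intro affine_span.add affine_span.const affine_span.scale) simp
      show "mono (\<lambda>t. 1/2 + 1/2 * tanh t :: real)"
        by (auto intro!: monoI)
      show "0 \<le> 1/2 + 1/2 * tanh t" "1/2 + 1/2 * tanh t \<le> 1" for t :: real
        using tanh_real_gt_neg1[of t] tanh_real_lt_1[of t] by auto
      have "((\<lambda>t::real. 1/2 + 1/2 * tanh t) \<longlongrightarrow> 1/2 + 1/2 * -1) at_bot"
        by (intro tendsto_intros tanh_real_at_bot)
      then show "((\<lambda>t::real. 1/2 + 1/2 * tanh t) \<longlongrightarrow> 0) at_bot" by simp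
      have "((\<lambda>t::real. 1/2 + 1/2 * tanh t) \<longlongrightarrow> 1/2 + 1/2 * 1) at_top"
        by (intro tendsto_intros tanh_real_at_top)
      then show "((\<lambda>t::real. 1/2 + 1/2 * tanh t) \<longlongrightarrow> 1) at_top" by simp
    qed
  next
    case 2
    show ?thesis
    proof (rule that)
      show "sigmoid \<in> affine_span (ridge_units \<sigma>)"
        using unit[of 1 0] 2 by simp
      show "mono sigmoid"
        by (intro monoI) (auto simp: sigmoid_def intro!: divide_left_mono mult_pos_pos add_pos_pos)
      show "0 \<le> sigmoid t" "sigmoid t \<le> 1" for t
        by (auto simp: sigmoid_def divide_simps add_pos_pos intro: add_nonneg_nonneg)
      show "(sigmoid \<longlongrightarrow> 0) at_bot" "(sigmoid \<longlongrightarrow> 1) at_top"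
        unfolding sigmoid_def by real_asymp+
    qed
  next
    case 3
    show ?thesis
    proof (rule that)
      show "(\<lambda>t. relu t + -1 * relu (t - 1)) \<in> affine_span (ridge_units \<sigma>)"
        using affine_span.add[OF unit[of 1 0] affine_span.scale[OF unit[of 1 "-1"]], of "-1"] 3 by simp
      show "mono (\<lambda>t. relu t + -1 * relu (t - 1))"
        by (rule monoI) (auto simp: relu_def max_def)
      show "0 \<le> relu t + -1 * relu (t - 1)" "relu t + -1 * relu (t - 1) \<le> 1" for t
        by (auto simp: relu_def max_def)
      show "((\<lambda>t. relu t + -1 * relu (t - 1)) \<longlongrightarrow> 0) at_bot"
        by (rule tendsto_eventually, rule eventually_mono[OF eventually_le_at_bot[of 0]])
           (auto simp: relu_def)
      show "((\<lambda>t. relu t + -1 * relu (t - 1)) \<longlongrightarrow> 1) at_top"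
        by (rule tendsto_eventually, rule eventually_mono[OF eventually_ge_at_top[of 1]])
           (auto simp: relu_def)
    qed
  qed
qed

text \<open>
  The range \<open>[v0, v1]\<close> of the exponential on \<open>[-T, T]\<close> is cut into \<open>L\<close> levels of height \<open>\<delta>\<close>, and a
  step of height \<open>\<delta>\<close> is placed at the point \<open>\<theta> l\<close> where the exponential reaches the level \<open>w l\<close>.
  Distinct \<open>\<theta> l\<close> are at least \<open>\<gamma>\<close> apart, so for steep steps all but at most two of them are, at a
  given \<open>t\<close>, within \<open>1 / L\<close> of 0 or 1.
\<close>
lemma exp_approx_by_ridge_units:
  assumes "\<sigma> \<in> {tanh, sigmoid, relu}" "T > 0" "e > 0"
  shows "\<exists>g \<in> affine_span (ridge_units \<sigma>). \<forall>t\<in>{-T..T}. \<bar>exp t - g t\<bar> \<le> e"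
proof -
  obtain s where s: "s \<in> affine_span (ridge_units \<sigma>)" "mono s" "\<And>t. 0 \<le> s t" "\<And>t. s t \<le> 1"
    and lim: "(s \<longlongrightarrow> 0) at_bot" "(s \<longlongrightarrow> 1) at_top"
    using sigmoidal_in_affine_span[OF assms(1)] by blast
  define v0 v1 where "v0 = exp (-T)" and "v1 = exp T"
  have v: "0 < v0" "v0 < v1" using assms by (auto simp: v0_def v1_def)
  obtain L :: nat where L: "3 * (v1 - v0) / e < L" using reals_Archimedean2 by blast
  have "0 < 3 * (v1 - v0) / e" using v assms by auto
  with L have Lpos: "0 < L" by (metis of_nat_0_less_iff less_trans)
  define \<delta> where "\<delta> = (v1 - v0) / L"
  have \<delta>: "\<delta> > 0" "3 * \<delta> \<le> e" "v0 + L * \<delta> = v1"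
    using v L Lpos assms by (auto simp: \<delta>_def field_simps)
  define \<gamma> where "\<gamma> = ln (1 + \<delta> / v1)"
  have \<gamma>: "\<gamma> > 0" unfolding \<gamma>_def by (rule ln_gt_zero) (use \<delta>(1) v in simp)
  \<comment> \<open>\<open>L\<close> steps, each off by at most \<open>\<kappa>\<close>, contribute a total error of one level\<close>
  define \<kappa> where "\<kappa> = 1 / real L"
  have \<kappa>: "\<kappa> > 0" "\<kappa> * L = 1" using Lpos by (auto simp: \<kappa>_def)
  have "eventually (\<lambda>t. s t > 1 - \<kappa>) at_top" "eventually (\<lambda>t. s t < \<kappa>) at_bot"
    using lim \<kappa> by (auto intro: order_tendstoD)
  then obtain X Y where X: "\<And>t. t \<ge> X \<Longrightarrow> s t > 1 - \<kappa>" and Y: "\<And>t. t \<le> Y \<Longrightarrow> s t < \<kappa>"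
    by (auto simp: eventually_at_top_linorder eventually_at_bot_linorder)
  \<comment> \<open>scaled by \<open>N\<close>, the transition of \<open>s\<close> takes place within \<open>\<gamma>\<close> of its center\<close>
  define N where "N = max 0 (max X (-Y)) / \<gamma>"
  have N: "N \<ge> 0" "N * \<gamma> \<ge> X" "- (N * \<gamma>) \<le> Y" using \<gamma> by (auto simp: N_def)
  define w where "w l = v0 + real l * \<delta>" for l
  define \<theta> where "\<theta> l = ln (w l)" for l
  have wpos: "w l > 0" for l using v \<delta> by (auto simp: w_def intro: add_pos_nonneg)
  have gap: "ln x + \<gamma> \<le> ln y" if "0 < x" "x \<le> v1" "x + \<delta> \<le> y" for x y
  proof -
    have "x * (1 + \<delta> / v1) \<le> x + \<delta>"
      using that \<delta> v by (simp add: field_simps)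
    also note that(3)
    finally have "ln (x * (1 + \<delta> / v1)) \<le> ln y"
      using that \<delta> v by (intro ln_mono) (auto intro!: mult_pos_pos add_pos_pos)
    moreover have "ln (x * (1 + \<delta> / v1)) = ln x + \<gamma>"
      unfolding \<gamma>_def using that \<delta> v by (intro ln_mult_pos) (auto intro!: add_pos_pos)
    ultimately show ?thesis by simp
  qed
  define g where "g t = v0 + (\<Sum>l\<in>{1..L}. \<delta> * s (N * t + - (N * \<theta> l)))" for t
  have "g \<in> affine_span (ridge_units \<sigma>)"
    unfolding g_def
    by (intro affine_span.add affine_span.const affine_span_sum affine_span.scale
          ridge_units_rescale s)
  moreover have "\<bar>exp t - g t\<bar> \<le> e" if t: "t \<in> {-T..T}" for t
  proof -
    have et: "v0 \<le> exp t" "exp t \<le> v1" using t by (auto simp: v0_def v1_def)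
    \<comment> \<open>\<open>j\<close> is the number of levels that the exponential has passed at \<open>t\<close>\<close>
    define j where "j = nat \<lfloor>(exp t - v0) / \<delta>\<rfloor>"
    have q0: "0 \<le> (exp t - v0) / \<delta>" using et \<delta> by auto
    have "real j \<le> (exp t - v0) / \<delta>" "(exp t - v0) / \<delta> < real j + 1"
      unfolding j_def using q0 by linarith+
    then have j: "w j \<le> exp t" "exp t < w (Suc j)"
      using \<delta> by (auto simp: w_def field_simps)
    have "real j * \<delta> \<le> real L * \<delta>" using j(1) et(2) \<delta>(3) unfolding w_def by linarith
    then have jL: "j \<le> L" using \<delta>(1) by simp
    have up: "s (N * t + - (N * \<theta> l)) \<le> \<kappa> + of_bool (l \<le> j + 1)" for l
    proof (cases "l \<le> j + 1")
      case False
      then have "real (Suc j) + 1 \<le> real l" by simp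
      then have "(real (Suc j) + 1) * \<delta> \<le> real l * \<delta>" using \<delta> by (intro mult_right_mono) auto
      then have "exp t + \<delta> \<le> w l" using j by (simp add: w_def algebra_simps)
      then have "t + \<gamma> \<le> \<theta> l" using gap[of "exp t" "w l"] et by (simp add: \<theta>_def)
      then have "N * (t + \<gamma>) \<le> N * \<theta> l" using N by (intro mult_left_mono)
      then have "N * t + - (N * \<theta> l) \<le> Y" using N by (simp add: algebra_simps)
      then show ?thesis using Y False by (simp add: less_imp_le)
    qed (use s(4) \<kappa> in \<open>auto intro: add_increasing\<close>)
    have lo: "of_bool (l < j) - \<kappa> \<le> s (N * t + - (N * \<theta> l))" for l
    proof (cases "l < j")
      case True
      then have "real l + 1 \<le> real j" by simp
      then have *: "(real l + 1) * \<delta> \<le> real j * \<delta>" using \<delta> by (intro mult_right_mono) auto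
      then have "w l + \<delta> \<le> exp t" "w l \<le> v1"
        using j et \<delta> by (auto simp: w_def algebra_simps)
      then have "\<theta> l + \<gamma> \<le> t" using gap[of "w l" "exp t"] wpos by (simp add: \<theta>_def)
      then have "N * (\<theta> l + \<gamma>) \<le> N * t" using N by (intro mult_left_mono)
      then have "X \<le> N * t + - (N * \<theta> l)" using N by (simp add: algebra_simps)
      from X[OF this] show ?thesis using True by simp
    qed (use s(3) \<kappa> in \<open>auto intro: order_trans[of _ 0]\<close>)
    let ?q = "\<Sum>l\<in>{1..L}. s (N * t + - (N * \<theta> l))"
    have "?q \<le> (\<Sum>l\<in>{1..L}. \<kappa> + of_bool (l \<le> j + 1))" by (intro sum_mono up)
    also have "\<dots> = 1 + real (card ({1..L} \<inter> {l. l \<le> j + 1}))"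
      using \<kappa> by (simp add: sum.distrib mult.commute)
    also have "card ({1..L} \<inter> {l. l \<le> j + 1}) \<le> card {1..j+1}"
      by (intro card_mono) auto
    finally have qu: "?q \<le> j + 2" by simp
    have "{1..L} \<inter> {l. l < j} = {1..<j}" using jL by auto
    then have "real j - 1 - 1 \<le> (\<Sum>l\<in>{1..L}. of_bool (l < j) - \<kappa>)"
      using \<kappa> by (simp add: sum_subtractf mult.commute)
    also have "\<dots> \<le> ?q" by (intro sum_mono lo)
    finally have ql: "real j - 2 \<le> ?q" by simp
    have g: "g t = v0 + \<delta> * ?q" by (simp add: g_def sum_distrib_left)
    have "\<delta> * ?q \<le> \<delta> * (j + 2)" "\<delta> * (real j - 2) \<le> \<delta> * ?q"
      using qu ql \<delta> by (auto intro: mult_left_mono)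
    then have "\<bar>exp t - g t\<bar> \<le> 3 * \<delta>"
      unfolding g using j \<delta>(1) by (simp add: w_def algebra_simps abs_le_iff)
    then show ?thesis using \<delta> by simp
  qed
  ultimately show ?thesis by blast
qed

section \<open>Density of networks with one hidden layer\<close>

text \<open>
  Coordinates from \<open>m\<close> on are zero, so that linear forms in the first \<open>m\<close> coordinates separate points.
\<close>
definition cube :: "nat \<Rightarrow> real \<Rightarrow> (nat \<Rightarrow> real) set" where
  "cube m R = PiE UNIV (\<lambda>i. if i < m then {-R..R} else {0})"

lemma compact_cube: "compact (cube m R)"
proof -
  have "compactin (product_topology (\<lambda>_. euclidean) UNIV) (cube m R)"
    unfolding cube_def by (subst compactin_PiE) auto
  then show ?thesis
    by (simp add: euclidean_product_topology)
qed

lemma continuous_on_linear_form: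
  "continuous_on S (\<lambda>z::nat \<Rightarrow> real. \<Sum>i<m. w i * z i)"
  by (intro continuous_intros continuous_on_product_coordinates[THEN continuous_on_subset]) auto

lemma linear_form_bound:
  assumes "z \<in> cube m R"
  shows "\<bar>\<Sum>i<m. w i * z i\<bar> \<le> (\<Sum>i<m. \<bar>w i\<bar> * R)"
proof -
  have "\<bar>z i\<bar> \<le> R" if "i < m" for i
    using PiE_mem[OF assms[unfolded cube_def], of i] that by (auto simp: abs_le_iff)
  then have "\<bar>w i * z i\<bar> \<le> \<bar>w i\<bar> * R" if "i < m" for i
    using that by (simp add: abs_mult mult_left_mono)
  then show ?thesis
    by (intro order_trans[OF sum_abs] sum_mono) auto
qed

text \<open>
  A linear form maps the cube into a bounded interval, so the one-dimensional approximation of the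
  exponential can be composed with it; a ridge unit composed with a linear form is a neuron.
\<close>
lemma exp_sums_approx_by_neurons:
  assumes "\<sigma> \<in> {tanh, sigmoid, relu}"
    and "f \<in> affine_span {\<lambda>z. exp (\<Sum>i<m. w i * z i) | w. True}" and "e > 0"
  shows "\<exists>g \<in> affine_span (neurons \<sigma> m). \<forall>z\<in>cube m R. \<bar>f z - g z\<bar> \<le> e"
  using assms(2,3)
proof (induction arbitrary: e)
  case (const c)
  then show ?case by (intro bexI[of _ "\<lambda>_. c"]) (auto intro: affine_span.const)
next
  case (base f)
  then obtain w where f: "f = (\<lambda>z. exp (\<Sum>i<m. w i * z i))" by blast
  define T where "T = max 1 (\<Sum>i<m. \<bar>w i\<bar> * R)"
  have "T > 0" by (simp add: T_def)
  with base obtain h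
    where h: "h \<in> affine_span (ridge_units \<sigma>)" "\<forall>t\<in>{-T..T}. \<bar>exp t - h t\<bar> \<le> e"
    using exp_approx_by_ridge_units[OF assms(1), of T e] by blast
  have "(\<lambda>z. h (\<Sum>i<m. w i * z i)) \<in> affine_span (neurons \<sigma> m)"
  proof (rule affine_span_comp[OF h(1)])
    fix g assume "g \<in> ridge_units \<sigma>"
    then obtain u v where g: "g = (\<lambda>t. \<sigma> (u * t + v))" by (auto simp: ridge_units_def)
    have "(\<lambda>z. g (\<Sum>i<m. w i * z i)) = (\<lambda>z. \<sigma> ((\<Sum>i<m. (u * w i) * z i) + v))"
      unfolding g by (simp add: sum_distrib_left mult.assoc)
    moreover have "\<dots> \<in> neurons \<sigma> m"
      unfolding neurons_def mem_Collect_eq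
      by (intro exI[of _ "\<lambda>i. u * w i"] exI[of _ v] conjI refl TrueI)
    ultimately show "(\<lambda>z. g (\<Sum>i<m. w i * z i)) \<in> affine_span (neurons \<sigma> m)"
      by (simp add: affine_span.base)
  qed
  moreover have "\<bar>f z - h (\<Sum>i<m. w i * z i)\<bar> \<le> e" if "z \<in> cube m R" for z
  proof -
    have "(\<Sum>i<m. w i * z i) \<in> {-T..T}"
      using linear_form_bound[OF that, of w] by (auto simp: T_def abs_le_iff)
    with h(2) show ?thesis by (simp add: f)
  qed
  ultimately show ?case by (intro bexI[of _ "\<lambda>z. h (\<Sum>i<m. w i * z i)"] ballI)
next
  case (add f1 f2)
  obtain g1 g2 where "g1 \<in> affine_span (neurons \<sigma> m)" "g2 \<in> affine_span (neurons \<sigma> m)"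
    and g: "\<forall>z\<in>cube m R. \<bar>f1 z - g1 z\<bar> \<le> e/2" "\<forall>z\<in>cube m R. \<bar>f2 z - g2 z\<bar> \<le> e/2"
    using add.IH(1)[of "e/2"] add.IH(2)[of "e/2"] add.prems by (meson half_gt_zero)
  moreover have "\<bar>f1 z + f2 z - (g1 z + g2 z)\<bar> \<le> e" if "z \<in> cube m R" for z
    using g[rule_format, OF that] by linarith
  ultimately show ?case by (intro bexI[of _ "\<lambda>z. g1 z + g2 z"] affine_span.add) auto
next
  case (scale f c)
  obtain g where g: "g \<in> affine_span (neurons \<sigma> m)" "\<forall>z\<in>cube m R. \<bar>f z - g z\<bar> \<le> e / (\<bar>c\<bar> + 1)"
    using scale.IH[of "e / (\<bar>c\<bar> + 1)"] scale.prems by (auto simp: add_nonneg_pos)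
  have "\<bar>c * f z - c * g z\<bar> \<le> e" if "z \<in> cube m R" for z
  proof -
    have "\<bar>c * f z - c * g z\<bar> = \<bar>c\<bar> * \<bar>f z - g z\<bar>"
      by (simp add: abs_mult flip: right_diff_distrib)
    also have "\<dots> \<le> (\<bar>c\<bar> + 1) * (e / (\<bar>c\<bar> + 1))"
      using g(2) that by (intro mult_mono) auto
    also have "\<dots> = e" by (simp add: add_nonneg_eq_0_iff)
    finally show ?thesis .
  qed
  then show ?case using g by (intro bexI[of _ "\<lambda>z. c * g z"] affine_span.scale) auto
qed

lemma affine_span_mult_closed:
  assumes "f \<in> affine_span B" "g \<in> affine_span B"
    and "\<And>p q. p \<in> B \<Longrightarrow> q \<in> B \<Longrightarrow> (\<lambda>x. p x * q x) \<in> B"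
  shows "(\<lambda>x. f x * g x) \<in> affine_span B"
  using assms(1)
proof induction
  case (base p)
  show ?case
    using assms(2)
  proof induction
    case (const c)
    then show ?case
      using affine_span.scale[OF affine_span.base[OF base], of c] by (simp add: mult.commute)
  next
    case (add q1 q2)
    then show ?case using affine_span.add[OF add.IH] by (simp add: distrib_left)
  next
    case (scale q c)
    then show ?case
      using affine_span.scale[OF scale.IH, of c] by (simp add: mult.left_commute)
  qed (use base assms(3) in \<open>auto intro: affine_span.base\<close>)
next
  case (add f1 f2)
  then show ?case using affine_span.add[OF add.IH] by (simp add: distrib_right)
next
  case (scale f c)
  then show ?case using affine_span.scale[OF scale.IH, of c] by (simp add: mult.assoc)
qed (use assms(2) in \<open>auto intro: affine_span.scale\<close>)

text \<open>
  Exponentials of linear forms are closed under products, so their span is an algebra, to which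
  Stone-Weierstrass applies; its elements are approximated by neurons.
\<close>
theorem neurons_dense:
  fixes G :: "(nat \<Rightarrow> real) \<Rightarrow> real"
  assumes \<sigma>: "\<sigma> \<in> {tanh, sigmoid, relu}" and G: "continuous_on (cube m R) G" and e: "e > 0"
  shows "\<exists>g \<in> affine_span (neurons \<sigma> m). \<forall>z\<in>cube m R. \<bar>G z - g z\<bar> \<le> e"
proof -
  let ?B = "{\<lambda>z. exp (\<Sum>i<m. w i * z i) | w. True} :: ((nat \<Rightarrow> real) \<Rightarrow> real) set"
  interpret function_ring_on "affine_span ?B" "cube m R"
  proof
    show "compact (cube m R)" by (rule compact_cube)
    show "continuous_on (cube m R) f" if "f \<in> affine_span ?B" for f
      using that by induction (auto intro!: continuous_intros continuous_on_linear_form)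
    show "(\<lambda>x. f x * g x) \<in> affine_span ?B" if "f \<in> affine_span ?B" "g \<in> affine_span ?B" for f g
    proof (rule affine_span_mult_closed[OF that])
      fix p q assume "p \<in> ?B" "q \<in> ?B"
      then obtain w w' where "p = (\<lambda>z. exp (\<Sum>i<m. w i * z i))" "q = (\<lambda>z. exp (\<Sum>i<m. w' i * z i))"
        by blast
      then have "(\<lambda>x. p x * q x) = (\<lambda>z. exp (\<Sum>i<m. (w i + w' i) * z i))"
        by (simp add: distrib_right sum.distrib exp_add)
      then show "(\<lambda>x. p x * q x) \<in> ?B" by auto
    qed
    show "\<exists>f\<in>affine_span ?B. f x \<noteq> f y" if "x \<in> cube m R" "y \<in> cube m R" and xy: "x \<noteq> y" for x y
    proof -
      obtain i where i: "x i \<noteq> y i" using xy by (meson ext)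
      have "i < m"
      proof (rule ccontr)
        assume "\<not> i < m"
        then have "x i = 0" "y i = 0"
          using PiE_mem[OF that(1)[unfolded cube_def], of i] PiE_mem[OF that(2)[unfolded cube_def], of i]
          by auto
        with i show False by simp
      qed
      then have "(\<Sum>j<m. of_bool (j = i) * z j) = z i" for z :: "nat \<Rightarrow> real"
        by (simp add: sum.delta' if_distrib[of "\<lambda>c. c * _"] of_bool_def cong: if_cong)
      moreover have "(\<lambda>z. exp (\<Sum>j<m. of_bool (j = i) * z j)) \<in> affine_span ?B"
        by (rule affine_span.base, unfold mem_Collect_eq)
           (intro exI[of _ "\<lambda>j. of_bool (j = i)"] conjI refl TrueI)
      ultimately show ?thesis using i by (intro bexI) auto
    qed
  qed (auto intro: affine_span.intros)
  obtain f where f: "f \<in> affine_span ?B" "\<forall>z\<in>cube m R. \<bar>G z - f z\<bar> < e/2"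
    using Stone_Weierstrass_basic[OF G, of "e/2"] e by auto
  obtain g where g: "g \<in> affine_span (neurons \<sigma> m)" "\<forall>z\<in>cube m R. \<bar>f z - g z\<bar> \<le> e/2"
    using exp_sums_approx_by_neurons[OF \<sigma> f(1), of "e/2" R] e by auto
  have "\<bar>G z - g z\<bar> \<le> e" if "z \<in> cube m R" for z
    using f(2)[rule_format, OF that] g(2)[rule_format, OF that] by linarith
  with g show ?thesis by blast
qed

lemma affine_span_neurons_list:
  assumes "f \<in> affine_span (neurons \<sigma> m)"
  shows "\<exists>L k. \<forall>z. f z = k + (\<Sum>(C, w, c)\<leftarrow>L. C * \<sigma> ((\<Sum>i<m. w i * z i) + c))"
  using assms
proof induction
  case (const k)
  show ?case by (intro exI[of _ "[]"] exI[of _ k]) simp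
next
  case (base f)
  then obtain w c where "f = (\<lambda>z. \<sigma> ((\<Sum>i<m. w i * z i) + c))" by (auto simp: neurons_def)
  then show ?case by (intro exI[of _ "[(1, w, c)]"] exI[of _ 0]) simp
next
  case (add f g)
  then obtain L k L' k' where
    "\<forall>z. f z = k + (\<Sum>(C, w, c)\<leftarrow>L. C * \<sigma> ((\<Sum>i<m. w i * z i) + c))"
    "\<forall>z. g z = k' + (\<Sum>(C, w, c)\<leftarrow>L'. C * \<sigma> ((\<Sum>i<m. w i * z i) + c))" by blast
  then show ?case by (intro exI[of _ "L @ L'"] exI[of _ "k + k'"]) simp
next
  case (scale f d)
  then obtain L k where
    f: "\<forall>z. f z = k + (\<Sum>(C, w, c)\<leftarrow>L. C * \<sigma> ((\<Sum>i<m. w i * z i) + c))" by blast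
  have "d * f z = d * k + (\<Sum>(C, w, c)\<leftarrow>map (\<lambda>(C, w, c). (d * C, w, c)) L. C * \<sigma> ((\<Sum>i<m. w i * z i) + c))" for z
    unfolding f[rule_format] by (induction L) (auto simp: algebra_simps)
  then show ?case by blast
qed

text \<open>
  The hidden layer is the concatenation of the neurons used by all outputs; each neuron carries the
  index of its output as a tag, and the output matrix is zero where the tag does not match.
\<close>
theorem affine_span_neurons_network:
  assumes f: "\<And>q. q < p \<Longrightarrow> f q \<in> affine_span (neurons \<sigma> m)" and p: "p > 0"
  shows "\<exists>\<Phi>. neural_network \<sigma> m p \<Phi> \<and>
    (\<forall>v\<in>carrier_vec m. \<forall>q<p. vec_index (\<Phi> v) q = f q (\<lambda>i. if i < m then vec_index v i else 0))"
proof -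
  have "\<forall>q\<in>{..<p}. \<exists>Lk. \<forall>z.
      f q z = snd Lk + (\<Sum>(C, w, c)\<leftarrow>fst Lk. C * \<sigma> ((\<Sum>i<m. w i * z i) + c))"
    using affine_span_neurons_list[OF f] by simp
  from bchoice[OF this] obtain LK where LK: "\<forall>q\<in>{..<p}. \<forall>z.
      f q z = snd (LK q) + (\<Sum>(C, w, c)\<leftarrow>fst (LK q). C * \<sigma> ((\<Sum>i<m. w i * z i) + c))"
    by blast
  define L where "L q = fst (LK q)" for q
  define k where "k q = snd (LK q)" for q
  have Lk: "f q z = k q + (\<Sum>(C, w, c)\<leftarrow>L q. C * \<sigma> ((\<Sum>i<m. w i * z i) + c))" if "q < p" for q z
    using LK that unfolding L_def k_def by blast
  \<comment> \<open>the first entry makes the hidden layer nonempty; its tag \<open>p\<close> belongs to no output\<close>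
  define H where "H = (p, 0, \<lambda>_. 0, 0) # concat (map (\<lambda>q. map (Pair q) (L q)) [0..<p])"
  define J where "J = length H"
  define W1 where "W1 = mat J m (\<lambda>(j, i). fst (snd (snd (H ! j))) i)"
  define c1 where "c1 = Matrix.vec J (\<lambda>j. snd (snd (snd (H ! j))))"
  define W2 where "W2 = mat p J (\<lambda>(q, j). if fst (H ! j) = q then fst (snd (H ! j)) else 0)"
  define c2 where "c2 = Matrix.vec p k"
  define \<Phi> where "\<Phi> = network_map \<sigma> [(W1, c1), (W2, c2)]"
  have J: "J > 0" by (simp add: J_def H_def)
  have nn: "neural_network \<sigma> m p \<Phi>"
    unfolding neural_network_def \<Phi>_def
    by (intro exI[of _ "[(W1, c1), (W2, c2)]"])
       (simp add: J p W1_def c1_def W2_def c2_def)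
  have "vec_index (\<Phi> v) r = f r (\<lambda>i. if i < m then vec_index v i else 0)"
    if v: "v \<in> carrier_vec m" and r: "r < p" for v r
  proof -
    let ?h = "\<lambda>(q, C, w, c). (if q = r then C else 0) * \<sigma> ((\<Sum>i<m. w i * vec_index v i) + c)"
    let ?g = "\<lambda>(C, w, c). C * \<sigma> ((\<Sum>i<m. w i * vec_index v i) + c)"
    define y where "y = map_vec \<sigma> (affine_layer (W1, c1) v)"
    have y: "dim_vec y = J" by (simp add: y_def c1_def)
    have yj: "vec_index y j =
        \<sigma> ((\<Sum>i<m. fst (snd (snd (H ! j))) i * vec_index v i) + snd (snd (snd (H ! j))))"
      if "j < J" for j
      using that v by (simp add: y_def W1_def c1_def scalar_prod_def atLeast0LessThan)
    have "\<Phi> v = W2 *\<^sub>v y + c2" by (simp add: \<Phi>_def y_def)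
    then have "vec_index (\<Phi> v) r =
        (\<Sum>j<J. (if fst (H ! j) = r then fst (snd (H ! j)) else 0) * vec_index y j) + k r"
      using r by (simp add: W2_def c2_def scalar_prod_def atLeast0LessThan y)
    also have "\<dots> = (\<Sum>j<J. ?h (H ! j)) + k r"
      by (simp add: yj case_prod_beta')
    also have "(\<Sum>j<J. ?h (H ! j)) = sum_list (map ?h H)"
      by (simp add: sum_list_sum_nth J_def atLeast0LessThan)
    also have "\<dots> = (\<Sum>q\<leftarrow>[0..<p]. sum_list (map ?h (map (Pair q) (L q))))"
    proof -
      have "sum_list (map ?h (concat (map (\<lambda>q. map (Pair q) (L q)) qs))) =
          (\<Sum>q\<leftarrow>qs. sum_list (map ?h (map (Pair q) (L q))))" for qs
        by (induction qs) auto
      then show ?thesis by (simp add: H_def)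
    qed
    also have "\<dots> = (\<Sum>q<p. if q = r then sum_list (map ?g (L q)) else 0)"
      unfolding interv_sum_list_conv_sum_set_nat set_upt atLeast0LessThan
      by (intro sum.cong refl) (auto simp: comp_def case_prod_beta' sum_list_triv)
    also have "\<dots> = sum_list (map ?g (L r))" using r by simp
    finally have "vec_index (\<Phi> v) r = k r + sum_list (map ?g (L r))" by simp
    also have "\<dots> = f r (\<lambda>i. if i < m then vec_index v i else 0)"
    proof -
      have "(\<Sum>i<m. w i * (if i < m then vec_index v i else 0)) = (\<Sum>i<m. w i * vec_index v i)" for w
        by (intro sum.cong) auto
      then show ?thesis unfolding Lk[OF r] by simp
    qed
    finally show ?thesis .
  qed
  with nn show ?thesis by blast
qed

section \<open>Approximation on the class of measures\<close>

lemma network_input_in_cube: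
  fixes a b :: "real^'d"
  assumes ab: "\<And>i. a $ i < b $ i" and n: "n \<ge> 1"
    and B: "\<And>x. x \<in> cbox a b \<Longrightarrow> norm x \<le> B"
    and x: "x \<in> cbox a b" and \<mu>: "\<mu> \<in> D_c S"
  shows "network_input a b n x \<mu> \<in> cube (CARD('d) + n ^ CARD('d)) (max B (1 / bin_volume a b n))"
  unfolding cube_def
proof (rule PiE_I)
  fix i :: nat
  let ?R = "max B (1 / bin_volume a b n)"
  consider "i < CARD('d)" | k where "i = CARD('d) + k" "k < n ^ CARD('d)"
    | "i \<ge> CARD('d) + n ^ CARD('d)"
    by (metis add_less_cancel_left le_add_diff_inverse not_le)
  then show "network_input a b n x \<mu> i \<in> (if i < CARD('d) + n ^ CARD('d) then {- ?R..?R} else {0})"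
  proof cases
    case 1
    then have "network_input a b n x \<mu> i = x $ from_nat_into UNIV i"
      by (simp add: network_input_def to_vec_def density_bins_def)
    moreover have "\<bar>x $ from_nat_into UNIV i\<bar> \<le> ?R"
      using component_le_norm_cart[of x "from_nat_into UNIV i"] B[OF x] by linarith
    ultimately show ?thesis using 1 by (simp add: abs_le_iff)
  next
    case 2
    then show ?thesis
      using density_bins_bounded[OF ab n \<mu> 2(2)] bin_volume_pos[OF ab n]
      by (auto simp: network_input_density le_max_iff_disj intro: order_trans[of _ 0])
  next
    case 3
    then show ?thesis by (simp add: network_input_def)
  qed
qed simp

theorem theorem2p1:
  fixes a b :: "real^'d"
    and \<omega> :: "real \<Rightarrow> real"
    and U :: "real set"
    and V :: "real^'d \<Rightarrow> (real^'d) measure \<Rightarrow> real^'p"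
    and \<sigma> :: "real \<Rightarrow> real"
    and \<epsilon> :: real
  assumes "\<And>i. a $ i < b $ i"
    and "modulus_of_continuity \<omega>"
    and "open U" and "0 \<in> U"
    and "W2_continuous V"
    and "\<sigma> \<in> {tanh, sigmoid, relu}"
    and "\<epsilon> > 0"
  shows "\<exists>n\<ge>1. \<exists>\<Phi>. neural_network \<sigma> (CARD('d) + n ^ CARD('d)) CARD('p) \<Phi> \<and>
           (\<forall>\<mu> \<in> D_c_mod (cbox a b) \<omega> U.
              bin_mass a b n \<mu> \<noteq> 0 \<and>
              (\<forall>x \<in> cbox a b.
                 norm (V x \<mu> - of_vec (\<Phi> (to_vec x @\<^sub>v density_bins a b n \<mu>))) \<le> \<epsilon>))"
proof -
  let ?S = "cbox a b" and ?D = "D_c_mod (cbox a b) \<omega> U"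
  note ab = assms(1) and mod = assms(2-4)
  \<comment> \<open>each of the \<open>CARD('p)\<close> components incurs one error from the interpolation and one from the network\<close>
  define e where "e = \<epsilon> / (2 * CARD('p))"
  have e: "e > 0" "CARD('p) * (2 * e) = \<epsilon>" using assms(7) by (auto simp: e_def)
  obtain N where N: "N \<ge> 1" "\<And>n \<mu>. n \<ge> N \<Longrightarrow> \<mu> \<in> ?D \<Longrightarrow> bin_mass a b n \<mu> > 0"
    using eventually_bin_mass_pos[OF ab mod] by blast
  obtain M where M: "\<And>x \<mu>. x \<in> ?S \<Longrightarrow> \<mu> \<in> ?D \<Longrightarrow> norm (V x \<mu>) \<le> M"
    using values_bounded[OF ab mod assms(5)] by blast
  obtain n \<eta> where n: "n \<ge> N" and \<eta>: "\<eta> > 0" and separate: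
    "\<And>x y \<mu> \<nu>. x \<in> ?S \<Longrightarrow> y \<in> ?S \<Longrightarrow> \<mu> \<in> ?D \<Longrightarrow> \<nu> \<in> ?D \<Longrightarrow>
       (\<Sum>i < CARD('d) + n ^ CARD('d). \<bar>network_input a b n x \<mu> i - network_input a b n y \<nu> i\<bar>) < \<eta> \<Longrightarrow>
       norm (V x \<mu> - V y \<nu>) \<le> e"
    using network_inputs_separate[OF ab mod assms(5) e(1)] by blast
  have n1: "n \<ge> 1" using n N by simp
  let ?m = "CARD('d) + n ^ CARD('d)"
  have "\<exists>G. continuous_on UNIV G \<and> (\<forall>x\<in>?S. \<forall>\<mu>\<in>?D. \<bar>G (network_input a b n x \<mu>) - V x \<mu> $ i\<bar> \<le> e)" for i
  proof -
    obtain G where G: "continuous_on UNIV G"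
      "\<And>p. p \<in> ?S \<times> ?D \<Longrightarrow> \<bar>G (network_input a b n (fst p) (snd p)) - V (fst p) (snd p) $ i\<bar> \<le> e"
    proof (rule Lipschitz_interpolation[of "?S \<times> ?D" "\<lambda>p. V (fst p) (snd p) $ i" M \<eta>
            "\<lambda>p. network_input a b n (fst p) (snd p)" ?m e])
      show "\<bar>V (fst p) (snd p) $ i\<bar> \<le> M" if "p \<in> ?S \<times> ?D" for p
        using M[of "fst p" "snd p"] component_le_norm_cart[of "V (fst p) (snd p)" i] that by auto
      show "\<bar>V (fst p) (snd p) $ i - V (fst q) (snd q) $ i\<bar> \<le> e"
        if "p \<in> ?S \<times> ?D" "q \<in> ?S \<times> ?D"
          "(\<Sum>i<?m. \<bar>network_input a b n (fst p) (snd p) i - network_input a b n (fst q) (snd q) i\<bar>) < \<eta>" for p q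
        using separate[of "fst p" "fst q" "snd p" "snd q"] that
          component_le_norm_cart[of "V (fst p) (snd p) - V (fst q) (snd q)" i] by auto
    qed (use \<eta> in auto)
    then show ?thesis by (intro exI[of _ G]) force
  qed
  then obtain G where G: "\<And>i. continuous_on UNIV (G i)"
    "\<And>i x \<mu>. x \<in> ?S \<Longrightarrow> \<mu> \<in> ?D \<Longrightarrow> \<bar>G i (network_input a b n x \<mu>) - V x \<mu> $ i\<bar> \<le> e"
    by metis
  obtain B where B: "\<And>x. x \<in> ?S \<Longrightarrow> norm x \<le> B"
    using bounded_cbox[of a b] by (auto simp: bounded_iff)
  define R where "R = max B (1 / bin_volume a b n)"
  have "\<exists>g \<in> affine_span (neurons \<sigma> ?m). \<forall>z\<in>cube ?m R. \<bar>G i z - g z\<bar> \<le> e" for i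
    by (rule neurons_dense[OF assms(6) continuous_on_subset[OF G(1)] e(1)]) simp
  then obtain g where g: "\<And>i. g i \<in> affine_span (neurons \<sigma> ?m)"
    "\<And>i z. z \<in> cube ?m R \<Longrightarrow> \<bar>G i z - g i z\<bar> \<le> e"
    by metis
  obtain \<Phi> where \<Phi>: "neural_network \<sigma> ?m CARD('p) \<Phi>"
    "\<And>v q. v \<in> carrier_vec ?m \<Longrightarrow> q < CARD('p) \<Longrightarrow>
      vec_index (\<Phi> v) q = g (from_nat_into (UNIV :: 'p set) q) (\<lambda>i. if i < ?m then vec_index v i else 0)"
    using affine_span_neurons_network[of "CARD('p)" "\<lambda>q. g (from_nat_into (UNIV :: 'p set) q)" \<sigma> ?m] g(1)
    by auto
  have "norm (V x \<mu> - of_vec (\<Phi> (to_vec x @\<^sub>v density_bins a b n \<mu>))) \<le> \<epsilon>"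
    if \<mu>: "\<mu> \<in> ?D" and x: "x \<in> ?S" for \<mu> x
  proof -
    let ?v = "to_vec x @\<^sub>v density_bins a b n \<mu>"
    let ?z = "network_input a b n x \<mu>"
    have v: "?v \<in> carrier_vec ?m" by (intro append_carrier_vec) (simp_all add: to_vec_def density_bins_def)
    have z: "?z \<in> cube ?m R"
      unfolding R_def
      by (rule network_input_in_cube[OF ab n1 B x, of \<mu> ?S]) (use \<mu> in \<open>auto simp: D_c_mod_def\<close>)
    have "\<bar>(V x \<mu> - of_vec (\<Phi> ?v)) $ i\<bar> \<le> 2 * e" for i
    proof -
      have "to_nat_on (UNIV :: 'p set) i < CARD('p)"
        by (rule to_nat_on_less_CARD)
      then have "of_vec (\<Phi> ?v) $ i = g i ?z"
        using \<Phi>(2)[OF v] by (simp add: of_vec_def network_input_def[abs_def])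
      then show ?thesis using G(2)[OF x \<mu>, of i] g(2)[OF z, of i] by simp
    qed
    then have "(\<Sum>i\<in>UNIV. \<bar>(V x \<mu> - of_vec (\<Phi> ?v)) $ i\<bar>) \<le> (\<Sum>i\<in>(UNIV::'p set). 2 * e)"
      by (intro sum_mono)
    also have "\<dots> = \<epsilon>" using e(2) by simp
    finally show ?thesis using norm_le_l1_cart[of "V x \<mu> - of_vec (\<Phi> ?v)"] by linarith
  qed
  moreover have "bin_mass a b n \<mu> \<noteq> 0" if "\<mu> \<in> ?D" for \<mu>
    using N(2)[OF n that] by simp
  ultimately show ?thesis using n1 \<Phi>(1) by blast
qed

end
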